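(* For each $n$, let $\mathbf d=(d(1),\dots,d(n))$ be a sequence of integers with $1\le d(1)\le\dots\le d(n)$ and even sum, let $M=\sum_i d(i)$, $\Delta=d(n)$, and let $p=p(n)\in(0,1)$ satisfy $p<1-\varepsilon$ for a constant $\varepsilon>0$ and $\Delta^2p^{-12}\log^{12}M\le \delta pM$ for a function $\delta=\delta(n)\to0$ with $\delta^{-1}=O(\log\log M)$. Let $G$ be a uniformly random simple graph on $[n]$ with degree sequence $\mathbf d$ and let $S\subseteq[n]$ be obtained by including each vertex independently with probability $p$ (independently of $G$). Let $C_p=\delta^{-1/16}p^{-1}\log M$. Then with probability $1-o(1)$: (a) $|S|=np\bigl(1\pm 3\sqrt{\log n/(pn)}\bigr)$; (b) $d(S)=pM\bigl(1\pm p^2M^{-1/4}\bigr)$; (c) $d_S(v)=p\,d(v)(1\pm 9\delta^{1/64})$ for all $v\in S$ with $d(v)>2\delta^{1/32}C_p$; (d) for all integers $0\le i\le \tfrac13 pC_p$, $$|n_i(\mathbf d_S)-n_i(\mathbf d_A)|\le \frac{p\,n_i(\mathbf d_A)}{C_p^3}(1+o(1))+\frac{pC_p^6}{\sqrt{\log M}}.$$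
   Context: $d(A)=\sum_{i\in A}d(i)$; $d_S(v)$ is the degree of $v$ in $G[S]$; $\mathbf d_S$ is the degree sequence of $G[S]$ and $n_i(\mathbf d_S)$ the number of vertices of $S$ of degree $i$ in $G[S]$. For a sequence $\mathbf x$, $n_k(\mathbf x)$ is the number of entries equal to $k$. Definition of $\mathbf d_A$: let $X_j\sim\mathrm{Bin}(j,p)$; for $k\ge0$ let $\tilde N(k)=\lfloor p\sum_{i\in[n]}\Pr(X_{d(i)}\le k)+\tfrac12\rfloor$ and $\tilde N(-1)=0$; $\mathbf d_A$ is the non-decreasing sequence with $n_k(\mathbf d_A)=\tilde N(k)-\tilde N(k-1)$. The notation $x=y(1\pm\epsilon)$ means $|x-y|\le\epsilon y$. Asymptotics are as $n\to\infty$. *)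

theory Defs
  imports "HOL-Probability.Probability" "HOL-Library.Landau_Symbols"
begin

definition graphs_deg :: "nat \<Rightarrow> (nat \<Rightarrow> nat) \<Rightarrow> nat set set set" where
  "graphs_deg n dd = {E. E \<subseteq> {e. e \<subseteq> {1..n} \<and> card e = 2} \<and>
      (\<forall>v\<in>{1..n}. card {e\<in>E. v \<in> e} = dd v)}"

definition random_graph :: "nat \<Rightarrow> (nat \<Rightarrow> nat) \<Rightarrow> nat set set pmf" where
  "random_graph n dd = pmf_of_set (graphs_deg n dd)"

definition random_subset :: "nat \<Rightarrow> real \<Rightarrow> nat set pmf" where
  "random_subset n q = map_pmf (\<lambda>f. {v\<in>{1..n}. f v}) (Pi_pmf {1..n} False (\<lambda>_. bernoulli_pmf q))"

definition degS :: "nat set set \<Rightarrow> nat set \<Rightarrow> nat \<Rightarrow> nat" where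
  "degS E S v = card {u\<in>S. {u, v} \<in> E}"

definition nS :: "nat set set \<Rightarrow> nat set \<Rightarrow> nat \<Rightarrow> nat" where
  "nS E S i = card {v\<in>S. degS E S v = i}"

definition Ntil :: "nat \<Rightarrow> (nat \<Rightarrow> nat) \<Rightarrow> real \<Rightarrow> nat \<Rightarrow> int" where
  "Ntil n dd q k = \<lfloor>q * (\<Sum>i\<in>{1..n}. measure_pmf.prob (binomial_pmf (dd i) q) {..k}) + 1/2\<rfloor>"

definition nA :: "nat \<Rightarrow> (nat \<Rightarrow> nat) \<Rightarrow> real \<Rightarrow> nat \<Rightarrow> int" where
  "nA n dd q k = Ntil n dd q k - (if k = 0 then 0 else Ntil n dd q (k - 1))"

end

theory Submission
  imports Defs "HOL-Real_Asymp.Real_Asymp"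
begin

text \<open>Parts (a) and (b) follow from Chebyshev's inequality and part (c) from a Chernoff bound, conditionally
  on \<open>G\<close>. For (d), write \<open>n\<^sub>i\<close> as a sum of indicators of the events \<open>A\<^sub>v\<close>: \<open>v \<in> S\<close> and \<open>d\<^sub>S(v) = i\<close>; by (c) only
  vertices of degree at most \<open>C\<^sub>p/2\<close> matter. Given \<open>G\<close>, the probability of \<open>A\<^sub>v\<close> does not depend on \<open>G\<close>, so the
  variance is the average over \<open>G\<close> of the sum of conditional covariances. These vanish unless the closed
  neighbourhoods of \<open>u\<close> and \<open>v\<close> meet; if they meet in at most two vertices, \<open>P(A\<^sub>u \<inter> A\<^sub>v)\<close> exceeds \<open>P(A\<^sub>u) P(A\<^sub>v)\<close> by
  at most the factor \<open>(\<epsilon>p)\<^sup>-\<^sup>2\<close>, and otherwise it is at most \<open>P(A\<^sub>u)\<close>. An edge switching shows that in \<open>G\<close>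
  the two situations have probability of order \<open>d(u) d(v) \<Delta> / M\<close> and \<open>(d(u) d(v) \<Delta> / M)\<^sup>2\<close>, and
  Chebyshev's inequality applies with \<open>\<eta> = 0\<close>.\<close>

section \<open>Edge switchings\<close>

text \<open>The difficulty is the sum of the covariances over all pairs. With only P(A_u and A_v)
  \<le> P(A_u) for every overlapping pair, the sum over v would cost a factor of order C_p^2
  \<Delta>, since overlap has probability of order C_p^2 \<Delta> / M and n may be as large as M. So
  P(A_v) has to be kept for the typical overlap, and only pairs of probability of order M^-2 may
  lose it; their total is at most the mean of the count because 24 C_p^4 \<Delta>^2 \<le> M.
  Averaging over G avoids singling out good graphs. The deviation allowed in Chebyshev's inequality
  is the relative error of (d) plus half of the additive one. The product of these two terms
  controls the part of the variance that is linear in the mean, and the square of the first controls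
  the quadratic part. The other half of the additive error is at least 4 and absorbs the rounding in
  d_A and the vertices of high degree.\<close>

definition nb :: "nat set set \<Rightarrow> nat \<Rightarrow> nat set" where
  "nb E v = {w. {w, v} \<in> E}"

lemma finite_graphs_deg: "finite (graphs_deg n dd)"
proof -
  have "graphs_deg n dd \<subseteq> Pow (Pow {1..n})"
    unfolding graphs_deg_def by auto
  then show ?thesis by (rule finite_subset) simp
qed

lemma graphs_deg_finite: "E \<in> graphs_deg n dd \<Longrightarrow> finite E"
  by (rule finite_subset[of E "Pow {1..n}"]) (auto simp: graphs_deg_def)

lemma graphs_deg_edge:
  assumes "E \<in> graphs_deg n dd" "{x, y} \<in> E"
  shows "x \<in> {1..n}" "y \<in> {1..n}" "x \<noteq> y"
proof -
  have "{x, y} \<subseteq> {1..n}" "card {x, y} = 2"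
    using assms unfolding graphs_deg_def by blast+
  then show "x \<in> {1..n}" "y \<in> {1..n}" "x \<noteq> y" by auto
qed

lemma nb_subset: "E \<in> graphs_deg n dd \<Longrightarrow> nb E v \<subseteq> {1..n} - {v}"
  using graphs_deg_edge unfolding nb_def by blast

lemma finite_nb: "E \<in> graphs_deg n dd \<Longrightarrow> finite (nb E v)"
  using nb_subset finite_subset by (metis finite_Diff finite_atLeastAtMost)

lemma card_nb:
  assumes E: "E \<in> graphs_deg n dd" and v: "v \<in> {1..n}"
  shows "card (nb E v) = dd v"
proof -
  have "bij_betw (\<lambda>w. {w, v}) (nb E v) {e \<in> E. v \<in> e}"
    unfolding bij_betw_def
  proof
    show "inj_on (\<lambda>w. {w, v}) (nb E v)"
      by (auto simp: inj_on_def doubleton_eq_iff)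
    have "\<exists>w. e = {w, v}" if "e \<in> E" "v \<in> e" for e
    proof -
      have "card e = 2" using E that unfolding graphs_deg_def by blast
      then obtain a b where "e = {a, b}" by (meson card_2_iff)
      then show ?thesis using that by auto
    qed
    then show "(\<lambda>w. {w, v}) ` nb E v = {e \<in> E. v \<in> e}"
      by (auto simp: nb_def image_iff)
  qed
  then have "card (nb E v) = card {e \<in> E. v \<in> e}" by (rule bij_betw_same_card)
  also have "\<dots> = dd v" using E v by (auto simp: graphs_deg_def)
  finally show ?thesis .
qed

text \<open>Each of u, v, x, y lies on exactly one removed and one new edge, so all degrees survive.
  The two non-edge hypotheses ensure that the new edges really enlarge the edge set.\<close>

lemma switch_mem_graphs_deg:
  assumes E: "E \<in> graphs_deg n dd"
    and dist: "distinct [u, v, x, y]"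
    and uv: "{u, v} \<in> E" and xy: "{x, y} \<in> E" and ux: "{u, x} \<notin> E" and vy: "{v, y} \<notin> E"
  shows "insert {u, x} (insert {v, y} (E - {{u, v}, {x, y}})) \<in> graphs_deg n dd" (is "?E' \<in> _")
proof -
  define F where "F = E - {{u, v}, {x, y}}"
  have fin: "finite F" unfolding F_def using graphs_deg_finite[OF E] by simp
  \<comment> \<open>Writing degrees as sums of edge indicators reduces the claim to an identity
    between the terms of the four switched edges.\<close>
  define g :: "nat \<Rightarrow> nat set \<Rightarrow> nat" where "g z e = of_bool (z \<in> e)" for z e
  have count: "card {e \<in> A. z \<in> e} = (\<Sum>e\<in>A. g z e)" if "finite A" for A z
    using that by (simp add: Collect_conj_eq Int_commute g_def)
  have E_eq: "E = insert {u, v} (insert {x, y} F)" using uv xy unfolding F_def by auto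
  have ne: "{u, v} \<noteq> {x, y}" "{u, x} \<noteq> {v, y}" using dist by (auto simp: doubleton_eq_iff)
  have nin: "{u, v} \<notin> F" "{x, y} \<notin> F" "{u, x} \<notin> F" "{v, y} \<notin> F"
    using ux vy unfolding F_def by auto
  have "card {e \<in> ?E'. z \<in> e} = card {e \<in> E. z \<in> e}" for z
  proof -
    have "card {e \<in> ?E'. z \<in> e} = (\<Sum>e\<in>?E'. g z e)"
      by (rule count) (use fin F_def in simp)
    also have "\<dots> = g z {u, x} + (g z {v, y} + (\<Sum>e\<in>F. g z e))"
      unfolding F_def[symmetric] using fin nin ne by simp
    also have "\<dots> = g z {u, v} + (g z {x, y} + (\<Sum>e\<in>F. g z e))"
      using dist by (auto simp: g_def)
    also have "\<dots> = (\<Sum>e\<in>E. g z e)"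
      unfolding E_eq using fin nin ne by simp
    also have "\<dots> = card {e \<in> E. z \<in> e}"
      by (rule count[symmetric]) (use graphs_deg_finite[OF E] in simp)
    finally show ?thesis .
  qed
  moreover have "?E' \<subseteq> {e. e \<subseteq> {1..n} \<and> card e = 2}"
    using E graphs_deg_edge[OF E uv] graphs_deg_edge[OF E xy] dist
    unfolding graphs_deg_def by auto
  ultimately show ?thesis using E unfolding graphs_deg_def by simp
qed

text \<open>The switching replaces the edges \<open>uv\<close>, \<open>xy\<close> by \<open>ux\<close>, \<open>vy\<close>. A graph containing \<open>uv\<close> admits
  at least \<open>M/2\<close> ordered choices of \<open>(x, y)\<close>, and a graph is reached with at most
  \<open>d(u) d(v)\<close> choices of \<open>(x, y)\<close>.\<close>
lemma switching:
  fixes dd :: "nat \<Rightarrow> nat" and D :: nat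
  assumes H: "finite H" "card H \<le> 3" and eH: "{u, v} \<notin> H"
    and u: "u \<in> {1..n}" and v: "v \<in> {1..n}"
    and D: "\<And>i. i \<in> {1..n} \<Longrightarrow> dd i \<le> D" "1 \<le> D"
    and big: "20 * D\<^sup>2 \<le> (\<Sum>i=1..n. dd i)"
  shows "card {E \<in> graphs_deg n dd. insert {u, v} H \<subseteq> E} * (\<Sum>i=1..n. dd i)
           \<le> 2 * dd u * dd v * card {E \<in> graphs_deg n dd. H \<subseteq> E}"
proof -
  define M where "M = (\<Sum>i=1..n. dd i)"
  define A where "A = {E \<in> graphs_deg n dd. insert {u, v} H \<subseteq> E}"
  define B where "B = {E \<in> graphs_deg n dd. H \<subseteq> E}"
  \<comment> \<open>Keeping \<open>{x, y}\<close> out of \<open>H\<close> lets \<open>H\<close>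
    survive the switching; the two exclusions make \<open>{u, x}\<close> and \<open>{v, y}\<close>
    non-edges.\<close>
  define good where "good E = {(x, y). {x, y} \<in> E - H \<and> x \<notin> insert u (nb E u) \<and> y \<notin> insert v (nb E v)}" for E
  \<comment> \<open>The pair (x, y) stays in the image: given it, the switching can be undone, which
    makes \<open>\<phi>\<close> injective.\<close>
  define \<phi> where "\<phi> = (\<lambda>(E, x, y). (insert {u, x} (insert {v, y} (E - {{u, v}, {x, y}})), x, y))"
  have finA: "finite A" "finite B" unfolding A_def B_def using finite_graphs_deg by auto
  have good_fin: "finite (good E)" if "E \<in> A" for E
  proof -
    have "good E \<subseteq> {1..n} \<times> {1..n}"
      using graphs_deg_edge[of E n dd] that unfolding good_def A_def by auto
    then show ?thesis by (rule finite_subset) simp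
  qed
  have good_card: "M \<le> 2 * card (good E)" if EA: "E \<in> A" for E
  proof -
    have E: "E \<in> graphs_deg n dd" and HE: "H \<subseteq> E" and uvE: "{u, v} \<in> E"
      using EA unfolding A_def by auto
    \<comment> \<open>\<open>T\<close> consists of the M ordered edges. Those spoiled by u, by v and
      by \<open>H\<close> lie in \<open>T1\<close>, in \<open>T2\<close> with coordinates exchanged,
      and in \<open>T3\<close>, of sizes at most D(D+1), D(D+1) and 3 * 2.\<close>
    define T where "T = (SIGMA x:{1..n}. nb E x)"
    define T1 where "T1 = (SIGMA x:insert u (nb E u). nb E x)"
    define T2 where "T2 = (SIGMA y:insert v (nb E v). nb E y)"
    define T3 where "T3 = {(x, y). {x, y} \<in> H}"
    have fin: "finite T" "finite T1" "finite T2"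
      unfolding T_def T1_def T2_def using finite_nb[OF E] by auto
    have cT: "card T = M"
      unfolding T_def M_def using finite_nb[OF E] card_nb[OF E] by (simp add: card_SigmaI)
    have c1: "card (SIGMA x:insert w (nb E w). nb E x) \<le> (D + 1) * D" if w: "w \<in> {1..n}" for w
    proof -
      have "card (SIGMA x:insert w (nb E w). nb E x) = (\<Sum>x\<in>insert w (nb E w). card (nb E x))"
        using finite_nb[OF E] by (intro card_SigmaI) auto
      also have "\<dots> \<le> (\<Sum>x\<in>insert w (nb E w). D)"
        using nb_subset[OF E, of w] w card_nb[OF E] D by (intro sum_mono) auto
      also have "\<dots> = card (insert w (nb E w)) * D" by simp
      also have "\<dots> \<le> (D + 1) * D"
      proof (rule mult_right_mono)
        have "card (insert w (nb E w)) \<le> Suc (card (nb E w))" by (rule card_insert_le_m1) auto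
        then show "card (insert w (nb E w)) \<le> D + 1"
          using card_nb[OF E w] D(1)[OF w] by simp
      qed simp
      finally show ?thesis .
    qed
    have finH: "finite T3" and c3: "card T3 \<le> 6"
    proof -
      have sub: "T3 \<subseteq> (\<Union>e\<in>H. {(x, y). {x, y} = e})" unfolding T3_def by auto
      have two: "finite {(x, y). {x, y} = e} \<and> card {(x, y). {x, y} = e} \<le> 2" if "e \<in> H" for e
      proof -
        have "card e = 2" using E HE that unfolding graphs_deg_def by blast
        then obtain a b where e: "e = {a, b}" by (meson card_2_iff)
        have sub: "{(x, y). {x, y} = e} \<subseteq> {(a, b), (b, a)}" unfolding e by (auto simp: doubleton_eq_iff)
        have "card {(x, y). {x, y} = e} \<le> card {(a, b), (b, a)}" by (rule card_mono[OF _ sub]) simp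
        also have "\<dots> \<le> 2" by (cases "a = b") simp_all
        finally show ?thesis using finite_subset[OF sub] by simp
      qed
      have finU: "finite (\<Union>e\<in>H. {(x, y). {x, y} = e})" using H two by auto
      then show "finite T3" using sub finite_subset by blast
      have "card T3 \<le> card (\<Union>e\<in>H. {(x, y). {x, y} = e})" by (rule card_mono[OF finU sub])
      also have "\<dots> \<le> (\<Sum>e\<in>H. card {(x, y). {x, y} = e})" by (rule card_UN_le[OF H(1)])
      also have "\<dots> \<le> (\<Sum>e\<in>H. 2)" using two by (intro sum_mono) auto
      also have "\<dots> \<le> 6" using H by simp
      finally show "card T3 \<le> 6" .
    qed
    have "T \<subseteq> good E \<union> (T1 \<union> (prod.swap ` T2 \<union> T3))"
    proof
      fix z assume "z \<in> T"
      then obtain x y where z: "z = (x, y)" and y: "{x, y} \<in> E"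
        unfolding T_def nb_def by (auto simp: insert_commute)
      show "z \<in> good E \<union> (T1 \<union> (prod.swap ` T2 \<union> T3))"
        using y unfolding z good_def T1_def T2_def T3_def nb_def image_def by (auto simp: insert_commute)
    qed
    then have "card T \<le> card (good E \<union> (T1 \<union> (prod.swap ` T2 \<union> T3)))"
      using fin finH good_fin[OF EA] by (intro card_mono) auto
    also have "\<dots> \<le> card (good E) + (card T1 + (card (prod.swap ` T2) + card T3))"
      by (meson card_Un_le le_trans add_le_mono order_refl)
    also have "\<dots> \<le> card (good E) + ((D + 1) * D + ((D + 1) * D + 6))"
      using c1[OF u] c1[OF v] c3 card_image_le[OF fin(3), of prod.swap]
      unfolding T1_def T2_def by (intro add_mono order_refl) linarith+
    finally have "M \<le> card (good E) + 2 * D\<^sup>2 + 2 * D + 6"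
      unfolding cT by (simp add: power2_eq_square algebra_simps)
    \<comment> \<open>At most 2 D^2 + 2 D + 6 \<le> 10 D^2 ordered edges are spoiled, and
      \<open>big\<close> makes this at most M/2; hence the factor 20.\<close>
    moreover have "1 \<le> D\<^sup>2" "D \<le> D\<^sup>2" using D(2) by (auto simp: power2_eq_square)
    ultimately show ?thesis using big unfolding M_def[symmetric] by linarith
  qed
  \<comment> \<open>Since uv is an edge, v is a neighbour of u and u one of v, so the exclusions in
    \<open>good\<close> also yield x \<noteq> v and y \<noteq> u.\<close>
  have sw: "distinct [u, v, x, y] \<and> {u, x} \<notin> E \<and> {v, y} \<notin> E" if "E \<in> A" "(x, y) \<in> good E" for E x y
    using that graphs_deg_edge[of E n dd x y] graphs_deg_edge[of E n dd u v]
    unfolding A_def good_def nb_def by (auto simp: insert_commute)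
  have "inj_on \<phi> (SIGMA E:A. good E)"
  proof (rule inj_on_inverseI)
    fix z assume "z \<in> (SIGMA E:A. good E)"
    then obtain E x y where z: "z = (E, x, y)" and E: "E \<in> A" and xy: "(x, y) \<in> good E" by auto
    have "{x, y} \<in> E" "{u, v} \<in> E" using E xy unfolding A_def good_def by auto
    with sw[OF E xy] show "(\<lambda>(E', x, y). (insert {u, v} (insert {x, y} (E' - {{u, x}, {v, y}})), x, y)) (\<phi> z) = z"
      unfolding z \<phi>_def by auto
  qed
  moreover have "\<phi> ` (SIGMA E:A. good E) \<subseteq> (SIGMA E:B. nb E u \<times> nb E v)"
  proof
    fix w assume "w \<in> \<phi> ` (SIGMA E:A. good E)"
    then obtain E x y where w: "w = \<phi> (E, x, y)" and E: "E \<in> A" and xy: "(x, y) \<in> good E" by auto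
    let ?E' = "insert {u, x} (insert {v, y} (E - {{u, v}, {x, y}}))"
    have m: "{x, y} \<in> E" "{x, y} \<notin> H" "{u, v} \<in> E" "H \<subseteq> E" "E \<in> graphs_deg n dd"
      using E xy unfolding A_def good_def by auto
    have "?E' \<in> graphs_deg n dd"
      using switch_mem_graphs_deg sw[OF E xy] m by blast
    moreover have "H \<subseteq> ?E'" using m eH by auto
    ultimately show "w \<in> (SIGMA E:B. nb E u \<times> nb E v)"
      unfolding w \<phi>_def B_def nb_def by (auto simp: insert_commute)
  qed
  moreover have finSB: "finite (SIGMA E:B. nb E u \<times> nb E v)"
    using finA finite_nb unfolding B_def by (intro finite_SigmaI) auto
  ultimately have "card (SIGMA E:A. good E) \<le> card (SIGMA E:B. nb E u \<times> nb E v)"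
    by (rule card_inj_on_le)
  also have "\<dots> = (\<Sum>E\<in>B. card (nb E u \<times> nb E v))"
    using finA finite_nb unfolding B_def by (intro card_SigmaI) auto
  also have "\<dots> = (\<Sum>E\<in>B. dd u * dd v)"
    using card_nb u v unfolding B_def by (intro sum.cong) (auto simp: card_cartesian_product)
  finally have up: "card (SIGMA E:A. good E) \<le> card B * (dd u * dd v)" by simp
  have "card A * M = (\<Sum>E\<in>A. M)" by simp
  also have "\<dots> \<le> (\<Sum>E\<in>A. 2 * card (good E))" using good_card by (intro sum_mono) auto
  also have "\<dots> = 2 * card (SIGMA E:A. good E)"
    using finA good_fin by (simp add: card_SigmaI sum_distrib_left)
  also have "\<dots> \<le> 2 * (card B * (dd u * dd v))" using up by simp
  finally show ?thesis unfolding A_def B_def M_def by (simp add: mult_ac)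
qed

lemma prob_random_graph:
  assumes "graphs_deg n dd \<noteq> {}"
  shows "measure_pmf.prob (random_graph n dd) {E. P E}
    = card {E \<in> graphs_deg n dd. P E} / card (graphs_deg n dd)"
  unfolding random_graph_def using assms finite_graphs_deg
  by (simp add: measure_pmf_of_set Collect_conj_eq[symmetric] Int_def conj_commute)

text \<open>Switching read as a conditional probability: given that \<open>H\<close> is present, uv
  is an edge with probability at most 2 d(u) d(v) / M. Iteration bounds the probability of small
  configurations edge by edge.\<close>

lemma prob_insert_edge:
  fixes dd :: "nat \<Rightarrow> nat" and D :: nat
  assumes ne: "graphs_deg n dd \<noteq> {}"
    and H: "finite H" "card H \<le> 3" and eH: "{u, v} \<notin> H"
    and u: "u \<in> {1..n}" and v: "v \<in> {1..n}"
    and D: "\<And>i. i \<in> {1..n} \<Longrightarrow> dd i \<le> D" "1 \<le> D"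
    and big: "20 * D\<^sup>2 \<le> (\<Sum>i=1..n. dd i)"
  shows "measure_pmf.prob (random_graph n dd) {E. insert {u, v} H \<subseteq> E}
    \<le> 2 * real (dd u) * real (dd v) / real (\<Sum>i=1..n. dd i) * measure_pmf.prob (random_graph n dd) {E. H \<subseteq> E}"
proof -
  have "1 \<le> D\<^sup>2" using D(2) by simp
  then have M: "0 < (\<Sum>i=1..n. dd i)" using big by linarith
  have "real (card {E \<in> graphs_deg n dd. insert {u, v} H \<subseteq> E} * (\<Sum>i=1..n. dd i))
           \<le> real (2 * dd u * dd v * card {E \<in> graphs_deg n dd. H \<subseteq> E})"
    using switching[OF H eH u v D big] by (rule of_nat_mono)
  then have *: "real (card {E \<in> graphs_deg n dd. insert {u, v} H \<subseteq> E})
       \<le> 2 * real (dd u) * real (dd v) / real (\<Sum>i=1..n. dd i) * card {E \<in> graphs_deg n dd. H \<subseteq> E}"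
    using M by (simp add: field_simps del: of_nat_sum insert_subset)
  show ?thesis
    unfolding prob_random_graph[OF ne] using divide_right_mono[OF *, of "card (graphs_deg n dd)"]
    by (simp del: insert_subset)
qed

section \<open>Bernoulli random subsets and tail bounds\<close>

lemma pmf_union_bound:
  assumes "finite W" "\<And>x. x \<in> set_pmf P \<Longrightarrow> A x \<Longrightarrow> \<exists>w\<in>W. B w x"
  shows "measure_pmf.prob P {x. A x} \<le> (\<Sum>w\<in>W. measure_pmf.prob P {x. B w x})"
proof -
  have "measure_pmf.prob P {x. A x} \<le> measure_pmf.prob P (\<Union>w\<in>W. {x. B w x})"
    by (rule measure_pmf.finite_measure_mono_AE) (use assms in \<open>auto simp: AE_measure_pmf_iff\<close>)
  also have "\<dots> \<le> (\<Sum>w\<in>W. measure_pmf.prob P {x. B w x})"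
    by (rule measure_pmf.finite_measure_subadditive_finite) (use assms in auto)
  finally show ?thesis .
qed

lemma pmf_prob_mono:
  assumes "\<And>x. x \<in> set_pmf P \<Longrightarrow> A x \<Longrightarrow> B x"
  shows "measure_pmf.prob P {x. A x} \<le> measure_pmf.prob P {x. B x}"
  by (rule measure_pmf.finite_measure_mono_AE) (use assms in \<open>auto simp: AE_measure_pmf_iff\<close>)

lemma pmf_prob_cong:
  assumes "\<And>x. x \<in> set_pmf P \<Longrightarrow> A x \<longleftrightarrow> B x"
  shows "measure_pmf.prob P {x. A x} = measure_pmf.prob P {x. B x}"
  by (intro antisym pmf_prob_mono) (use assms in auto)

lemma integrable_pmf_bounded:
  fixes f :: "'a \<Rightarrow> real"
  assumes "\<And>x. \<bar>f x\<bar> \<le> B"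
  shows "integrable (measure_pmf P) f"
  by (rule measure_pmf.integrable_const_bound[where B = B]) (use assms in auto)

lemma prob_pair_pmf:
  "measure_pmf.prob (pair_pmf P Q) {(x, y). R x y}
     = measure_pmf.expectation P (\<lambda>x. measure_pmf.prob Q {y. R x y})"
proof -
  have "ennreal (measure_pmf.prob (pair_pmf P Q) {(x, y). R x y})
      = (\<integral>\<^sup>+z. indicator {(x, y). R x y} z \<partial>pair_pmf P Q)"
    by (simp add: measure_pmf.emeasure_eq_measure)
  also have "\<dots> = (\<integral>\<^sup>+x. \<integral>\<^sup>+y. indicator {(x, y). R x y} (x, y) \<partial>Q \<partial>P)"
    by (rule nn_integral_pair_pmf')
  also have "\<dots> = (\<integral>\<^sup>+x. \<integral>\<^sup>+y. indicator {y. R x y} y \<partial>Q \<partial>P)"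
    by (intro nn_integral_cong) (auto simp: indicator_def)
  also have "\<dots> = (\<integral>\<^sup>+x. ennreal (measure_pmf.prob Q {y. R x y}) \<partial>P)"
    by (simp add: measure_pmf.emeasure_eq_measure)
  also have "\<dots> = ennreal (measure_pmf.expectation P (\<lambda>x. measure_pmf.prob Q {y. R x y}))"
    by (intro nn_integral_eq_integral integrable_pmf_bounded[where B = 1]) auto
  finally show ?thesis by (simp add: integral_nonneg_AE)
qed

lemma prob_pair_pmf_le:
  assumes "\<And>x. x \<in> set_pmf P \<Longrightarrow> measure_pmf.prob Q {y. R x y} \<le> c"
  shows "measure_pmf.prob (pair_pmf P Q) {(x, y). R x y} \<le> c"
proof -
  have "measure_pmf.expectation P (\<lambda>x. measure_pmf.prob Q {y. R x y}) \<le> measure_pmf.expectation P (\<lambda>x. c)"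
  proof (rule integral_mono_AE)
    show "integrable (measure_pmf P) (\<lambda>x. measure_pmf.prob Q {y. R x y})"
      by (rule integrable_pmf_bounded[where B = 1]) auto
  qed (use assms in \<open>auto simp: AE_measure_pmf_iff\<close>)
  then show ?thesis by (simp add: prob_pair_pmf)
qed

lemma prob_pair_pmf_times:
  "measure_pmf.prob (pair_pmf P Q) {(x, y). A x \<and> B y}
     = measure_pmf.prob P {x. A x} * measure_pmf.prob Q {y. B y}"
proof -
  have "measure_pmf.prob Q {y. A x \<and> B y} = indicator {x. A x} x * measure_pmf.prob Q {y. B y}" for x
    by (auto simp: indicator_def)
  then have "measure_pmf.expectation P (\<lambda>x. measure_pmf.prob Q {y. A x \<and> B y})
      = measure_pmf.expectation P (\<lambda>x. indicator {x. A x} x * measure_pmf.prob Q {y. B y})"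
    by (intro Bochner_Integration.integral_cong refl)
  also have "\<dots> = measure_pmf.prob P {x. A x} * measure_pmf.prob Q {y. B y}" by simp
  finally show ?thesis unfolding prob_pair_pmf .
qed

text \<open>The variance of a weighted indicator sum is the weighted sum of the covariances, so the
  events may be dependent. Unit weights serve |S| and the degree counts, the weights d(v) serve
  d(S).\<close>

lemma pmf_weighted_chebyshev:
  fixes w :: "'b \<Rightarrow> real"
  assumes L: "finite L" and t: "0 < t"
  shows "measure_pmf.prob P {x. t < \<bar>(\<Sum>v\<in>L. w v * of_bool (A v x)) - (\<Sum>v\<in>L. w v * measure_pmf.prob P {x. A v x})\<bar>}
    \<le> (\<Sum>u\<in>L. \<Sum>v\<in>L. w u * w v * (measure_pmf.prob P {x. A u x \<and> A v x}
          - measure_pmf.prob P {x. A u x} * measure_pmf.prob P {x. A v x})) / t\<^sup>2"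
proof -
  define m where "m v = measure_pmf.prob P {x. A v x}" for v
  define f where "f x = (\<Sum>v\<in>L. w v * of_bool (A v x))" for x
  have ex: "measure_pmf.expectation P (\<lambda>x. of_bool (B x)) = measure_pmf.prob P {x. B x}" for B
  proof -
    have "(\<lambda>x. of_bool (B x) :: real) = indicator {x. B x}" by (auto simp: indicator_def)
    then show ?thesis by simp
  qed
  have m01: "0 \<le> m v" "m v \<le> 1" for v unfolding m_def by auto
  have bdf: "\<bar>f x\<bar> \<le> (\<Sum>v\<in>L. \<bar>w v\<bar>)" for x
    unfolding f_def by (rule order_trans[OF sum_abs]) (auto intro!: sum_mono simp: abs_mult)
  have Ef: "measure_pmf.expectation P f = (\<Sum>v\<in>L. w v * m v)"
    unfolding f_def m_def by (simp add: ex integrable_pmf_bounded[where B = 1])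
  have "(f x - (\<Sum>v\<in>L. w v * m v))\<^sup>2
      = (\<Sum>u\<in>L. \<Sum>v\<in>L. w u * w v * ((of_bool (A u x) - m u) * (of_bool (A v x) - m v)))" for x
    unfolding f_def sum_subtractf[symmetric] power2_eq_square sum_product
    by (intro sum.cong refl) (simp add: algebra_simps)
  then have "measure_pmf.variance P f = measure_pmf.expectation P
      (\<lambda>x. \<Sum>u\<in>L. \<Sum>v\<in>L. w u * w v * ((of_bool (A u x) - m u) * (of_bool (A v x) - m v)))"
    unfolding Ef by simp
  also have "\<dots> = (\<Sum>u\<in>L. \<Sum>v\<in>L. w u * w v * measure_pmf.expectation P
      (\<lambda>x. (of_bool (A u x) - m u) * (of_bool (A v x) - m v)))"
  proof -
    have "integrable (measure_pmf P) (\<lambda>x. (of_bool (A u x) - m u) * (of_bool (A v x) - m v))" for u v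
      using m01[of u] m01[of v]
      by (intro integrable_pmf_bounded[where B = "1 * 1"])
         (unfold abs_mult, intro mult_mono, auto simp: abs_if)
    then show ?thesis by (simp add: Bochner_Integration.integral_sum)
  qed
  also have "\<dots> = (\<Sum>u\<in>L. \<Sum>v\<in>L. w u * w v * (measure_pmf.prob P {x. A u x \<and> A v x} - m u * m v))"
  proof -
    have "measure_pmf.expectation P (\<lambda>x. (of_bool (A u x) - m u) * (of_bool (A v x) - m v))
        = measure_pmf.expectation P (\<lambda>x. of_bool (A u x \<and> A v x) - m u * of_bool (A v x)
            - m v * of_bool (A u x) + m u * m v)" for u v
      by (intro Bochner_Integration.integral_cong refl) (auto simp: algebra_simps)
    also have "\<dots> u v = measure_pmf.prob P {x. A u x \<and> A v x} - m u * m v - m v * m u + m u * m v" for u v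
    proof -
      have i: "integrable (measure_pmf P) (\<lambda>x. of_bool (B x) :: real)" for B
        by (rule integrable_pmf_bounded[where B = 1]) auto
      show ?thesis by (simp add: i ex m_def del: of_bool_conj)
    qed
    finally show ?thesis by (intro sum.cong refl) simp
  qed
  finally have var: "measure_pmf.variance P f
      = (\<Sum>u\<in>L. \<Sum>v\<in>L. w u * w v * (measure_pmf.prob P {x. A u x \<and> A v x} - m u * m v))" .
  have "measure_pmf.prob P {x. t < \<bar>f x - measure_pmf.expectation P f\<bar>}
      \<le> measure_pmf.prob P {x \<in> space (measure_pmf P). t \<le> \<bar>f x - measure_pmf.expectation P f\<bar>}"
    by (rule measure_pmf.finite_measure_mono) auto
  also have "\<dots> \<le> measure_pmf.variance P f / t\<^sup>2"
  proof (rule measure_pmf.Chebyshev_inequality)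
    have "\<bar>(f x)\<^sup>2\<bar> \<le> (\<Sum>v\<in>L. \<bar>w v\<bar>)\<^sup>2" for x
      using power_mono[OF bdf[of x], of 2] by simp
    then show "integrable (measure_pmf P) (\<lambda>x. (f x)\<^sup>2)"
      by (rule integrable_pmf_bounded)
  qed (use t in auto)
  finally show ?thesis unfolding var unfolding Ef unfolding f_def m_def .
qed

section \<open>Random subsets with independent memberships\<close>

definition bern_subset :: "'a set \<Rightarrow> real \<Rightarrow> 'a set pmf" where
  "bern_subset V q = map_pmf (\<lambda>f. {v\<in>V. f v}) (Pi_pmf V False (\<lambda>_. bernoulli_pmf q))"

lemma random_subset_conv_bern: "random_subset n q = bern_subset {1..n} q"
  unfolding random_subset_def bern_subset_def ..

lemma set_bern_subset: "S \<in> set_pmf (bern_subset V q) \<Longrightarrow> S \<subseteq> V"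
  unfolding bern_subset_def by auto

text \<open>This closure under restriction is why the ground set is arbitrary: local events are
  moved to the small set on which they depend.\<close>

lemma bern_subset_Int:
  assumes "finite V" "X \<subseteq> V"
  shows "map_pmf (\<lambda>S. S \<inter> X) (bern_subset V q) = bern_subset X q"
  unfolding bern_subset_def Pi_pmf_subset[OF assms] map_pmf_comp
  by (intro map_pmf_cong refl) (use assms in auto)

lemma bern_subset_Un:
  assumes "finite X" "finite Y" "X \<inter> Y = {}"
  shows "bern_subset (X \<union> Y) q = map_pmf (\<lambda>(S, T). S \<union> T) (pair_pmf (bern_subset X q) (bern_subset Y q))"
proof -
  have *: "pair_pmf (bern_subset X q) (bern_subset Y q) = map_pmf (\<lambda>(f, g). ({v\<in>X. f v}, {v\<in>Y. g v}))
     (pair_pmf (Pi_pmf X False (\<lambda>_. bernoulli_pmf q)) (Pi_pmf Y False (\<lambda>_. bernoulli_pmf q)))"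
    unfolding bern_subset_def by (rule map_pair[symmetric])
  show ?thesis
    unfolding * unfolding bern_subset_def Pi_pmf_union[OF assms] map_pmf_comp
    by (intro map_pmf_cong refl) (use assms in auto)
qed

lemma bern_subset_card:
  assumes "finite V" "0 \<le> q" "q \<le> 1"
  shows "map_pmf card (bern_subset V q) = binomial_pmf (card V) q"
  unfolding bern_subset_def map_pmf_comp
  by (rule binomial_pmf_altdef'[symmetric]) (use assms in auto)

lemma prob_bern_subset_Int:
  assumes "finite V" "X \<subseteq> V"
  shows "measure_pmf.prob (bern_subset V q) {S. P (S \<inter> X)} = measure_pmf.prob (bern_subset X q) {S. P S}"
  unfolding bern_subset_Int[OF assms, symmetric] by (simp add: vimage_def)

lemma prob_bern_subset_card:
  assumes "finite V" "X \<subseteq> V" "0 \<le> q" "q \<le> 1"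
  shows "measure_pmf.prob (bern_subset V q) {S. P (card (S \<inter> X))}
    = measure_pmf.prob (binomial_pmf (card X) q) {k. P k}"
proof -
  have "finite X" using assms finite_subset by blast
  then show ?thesis
    unfolding prob_bern_subset_Int[OF assms(1,2), of q "\<lambda>S. P (card S)"]
    using bern_subset_card[of X q] assms by (simp add: vimage_def flip: bern_subset_card)
qed

lemma prob_bern_subset_singleton:
  assumes "finite D" "\<sigma> \<subseteq> D" "0 \<le> q" "q \<le> 1"
  shows "measure_pmf.prob (bern_subset D q) {S. S = \<sigma>} = (\<Prod>v\<in>D. if v \<in> \<sigma> then q else 1 - q)"
proof -
  have "measure_pmf.prob (bern_subset D q) {S. S = \<sigma>}
      = measure_pmf.prob (Pi_pmf D False (\<lambda>_. bernoulli_pmf q)) (Pi D (\<lambda>v. {v \<in> \<sigma>}))"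
    unfolding bern_subset_def using assms(2)
    by (simp add: vimage_def) (intro arg_cong[where f = "measure_pmf.prob _"], auto simp: Pi_def)
  also have "\<dots> = (\<Prod>v\<in>D. measure_pmf.prob (bernoulli_pmf q) {v \<in> \<sigma>})"
    by (rule measure_Pi_pmf_Pi[OF assms(1)])
  also have "\<dots> = (\<Prod>v\<in>D. if v \<in> \<sigma> then q else 1 - q)"
    by (intro prod.cong refl) (use assms in \<open>auto simp: measure_pmf_single\<close>)
  finally show ?thesis .
qed

lemma prob_bern_subset_mem:
  assumes "finite V" "v \<in> V" "0 \<le> q" "q \<le> 1"
  shows "measure_pmf.prob (bern_subset V q) {S. v \<in> S} = q"
proof -
  have "measure_pmf.prob (bern_subset V q) {S. v \<in> S} = measure_pmf.prob (bern_subset V q) {S. S \<inter> {v} = {v}}"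
    by (rule pmf_prob_cong) auto
  also have "\<dots> = measure_pmf.prob (bern_subset {v} q) {S. S = {v}}"
    by (rule prob_bern_subset_Int) (use assms in auto)
  also have "\<dots> = q" by (subst prob_bern_subset_singleton) (use assms in auto)
  finally show ?thesis .
qed

text \<open>After restriction to \<open>X \<union> Y\<close> the random set is a union of
  independent random subsets of \<open>X\<close> and \<open>Y\<close>, and \<open>P\<close> and
  \<open>Q\<close> each see only one of them.\<close>

lemma bern_subset_indep:
  assumes V: "finite V" "X \<subseteq> V" "Y \<subseteq> V" and XY: "X \<inter> Y = {}"
  shows "measure_pmf.prob (bern_subset V q) {S. P (S \<inter> X) \<and> Q (S \<inter> Y)}
    = measure_pmf.prob (bern_subset V q) {S. P (S \<inter> X)} * measure_pmf.prob (bern_subset V q) {S. Q (S \<inter> Y)}"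
proof -
  have fin: "finite X" "finite Y" using V finite_subset by blast+
  have "measure_pmf.prob (bern_subset V q) {S. P (S \<inter> X) \<and> Q (S \<inter> Y)}
      = measure_pmf.prob (bern_subset V q) {S. P (S \<inter> (X \<union> Y) \<inter> X) \<and> Q (S \<inter> (X \<union> Y) \<inter> Y)}"
    by (simp add: Int_assoc Un_Int_eq Int_absorb1 Int_Un_distrib2)
  also have "\<dots> = measure_pmf.prob (bern_subset (X \<union> Y) q) {S. P (S \<inter> X) \<and> Q (S \<inter> Y)}"
    by (rule prob_bern_subset_Int) (use V in auto)
  also have "\<dots> = measure_pmf.prob (pair_pmf (bern_subset X q) (bern_subset Y q))
      {(S, T). P ((S \<union> T) \<inter> X) \<and> Q ((S \<union> T) \<inter> Y)}"
    unfolding bern_subset_Un[OF fin XY] by (simp add: vimage_def case_prod_unfold)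
  also have "\<dots> = measure_pmf.prob (pair_pmf (bern_subset X q) (bern_subset Y q)) {(S, T). P S \<and> Q T}"
  proof -
    have "(S \<union> T) \<inter> X = S \<and> (S \<union> T) \<inter> Y = T" if "S \<subseteq> X" "T \<subseteq> Y" for S T
      using that XY by blast
    then show ?thesis unfolding case_prod_unfold
      by (intro pmf_prob_cong) (auto dest!: set_bern_subset)
  qed
  also have "\<dots> = measure_pmf.prob (bern_subset X q) {S. P S} * measure_pmf.prob (bern_subset Y q) {S. Q S}"
    by (rule prob_pair_pmf_times)
  finally show ?thesis using V by (simp add: prob_bern_subset_Int)
qed

text \<open>Condition on the restriction of \<open>S\<close> to the overlap \<open>X \<inter> Y\<close>: every value of it has probability at
  least \<open>\<kappa> ^ card (X \<inter> Y)\<close>, so conditioning increases a probability by at most the inverse factor.\<close>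
lemma bern_subset_overlap:
  assumes V: "finite V" "X \<subseteq> V" "Y \<subseteq> V" and \<kappa>: "0 < \<kappa>" "\<kappa> \<le> q" "\<kappa> \<le> 1 - q"
  shows "\<kappa> ^ card (X \<inter> Y) * measure_pmf.prob (bern_subset V q) {S. P (S \<inter> X) \<and> Q (S \<inter> Y)}
    \<le> measure_pmf.prob (bern_subset V q) {S. P (S \<inter> X)} * measure_pmf.prob (bern_subset V q) {S. Q (S \<inter> Y)}"
proof -
  let ?p = "measure_pmf.prob (bern_subset V q)"
  define D where "D = X \<inter> Y"
  have finD: "finite D" unfolding D_def using V finite_subset by blast
  \<comment> \<open>Once the pattern \<open>\<sigma>\<close> on the overlap is fixed,
    \<open>Q\<close> depends only on \<open>S \<inter> (Y - D)\<close>, and \<open>Y - D\<close> is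
    disjoint from \<open>X\<close>.\<close>
  have cond: "\<kappa> ^ card D * ?p {S. P (S \<inter> X) \<and> Q (S \<inter> Y) \<and> S \<inter> D = \<sigma>}
      \<le> ?p {S. P (S \<inter> X) \<and> S \<inter> D = \<sigma>} * ?p {S. Q (S \<inter> Y)}" if \<sigma>: "\<sigma> \<subseteq> D" for \<sigma>
  proof -
    have sX: "S \<inter> X \<inter> D = S \<inter> D" for S unfolding D_def by auto
    have "?p {S. P (S \<inter> X) \<and> Q (S \<inter> Y) \<and> S \<inter> D = \<sigma>}
        = ?p {S. (P (S \<inter> X) \<and> S \<inter> X \<inter> D = \<sigma>) \<and> Q (\<sigma> \<union> (S \<inter> (Y - D)))}"
    proof (rule pmf_prob_cong)
      fix S
      have "S \<inter> Y = \<sigma> \<union> (S \<inter> (Y - D))" if "S \<inter> D = \<sigma>" using that unfolding D_def by auto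
      then show "(P (S \<inter> X) \<and> Q (S \<inter> Y) \<and> S \<inter> D = \<sigma>)
        = ((P (S \<inter> X) \<and> S \<inter> X \<inter> D = \<sigma>) \<and> Q (\<sigma> \<union> (S \<inter> (Y - D))))"
        unfolding sX by auto
    qed
    also have "\<dots> = ?p {S. P (S \<inter> X) \<and> S \<inter> X \<inter> D = \<sigma>} * ?p {S. Q (\<sigma> \<union> (S \<inter> (Y - D)))}"
      by (rule bern_subset_indep[OF V(1,2), where Q = "\<lambda>T. Q (\<sigma> \<union> T)" and P = "\<lambda>T. P T \<and> T \<inter> D = \<sigma>"])
         (use V in \<open>auto simp: D_def\<close>)
    finally have 1: "?p {S. P (S \<inter> X) \<and> Q (S \<inter> Y) \<and> S \<inter> D = \<sigma>}
      = ?p {S. P (S \<inter> X) \<and> S \<inter> D = \<sigma>} * ?p {S. Q (\<sigma> \<union> (S \<inter> (Y - D)))}" unfolding sX .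
    \<comment> \<open>Prescribing the pattern \<open>\<sigma>\<close> independently produces a
      subevent of \<open>Q (S \<inter> Y)\<close>; this is where the conditioning is paid
      for.\<close>
    have "?p {S. S \<inter> D = \<sigma>} * ?p {S. Q (\<sigma> \<union> (S \<inter> (Y - D)))}
        = ?p {S. S \<inter> D = \<sigma> \<and> Q (\<sigma> \<union> (S \<inter> (Y - D)))}"
      by (rule bern_subset_indep[where Q = "\<lambda>T. Q (\<sigma> \<union> T)" and P = "\<lambda>T. T = \<sigma>", symmetric])
         (use V in \<open>auto simp: D_def\<close>)
    also have "\<dots> \<le> ?p {S. Q (S \<inter> Y)}"
    proof (rule pmf_prob_mono)
      fix S assume *: "S \<inter> D = \<sigma> \<and> Q (\<sigma> \<union> (S \<inter> (Y - D)))"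
      then have "S \<inter> Y = \<sigma> \<union> (S \<inter> (Y - D))" unfolding D_def by auto
      with * show "Q (S \<inter> Y)" by simp
    qed
    finally have 2: "?p {S. S \<inter> D = \<sigma>} * ?p {S. Q (\<sigma> \<union> (S \<inter> (Y - D)))} \<le> ?p {S. Q (S \<inter> Y)}" .
    have "?p {S. S \<inter> D = \<sigma>} = (\<Prod>v\<in>D. if v \<in> \<sigma> then q else 1 - q)"
      using prob_bern_subset_Int[of V D q "\<lambda>S. S = \<sigma>"] prob_bern_subset_singleton[of D \<sigma> q] V \<kappa> finD \<sigma>
      unfolding D_def by auto
    also have "\<dots> \<ge> (\<Prod>v\<in>D. \<kappa>)" using \<kappa> by (intro prod_mono) auto
    finally have 3: "\<kappa> ^ card D \<le> ?p {S. S \<inter> D = \<sigma>}" by simp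
    have "\<kappa> ^ card D * ?p {S. Q (\<sigma> \<union> (S \<inter> (Y - D)))} \<le> ?p {S. Q (S \<inter> Y)}"
      by (rule order_trans[OF mult_right_mono[OF 3] 2]) simp
    then have "?p {S. P (S \<inter> X) \<and> S \<inter> D = \<sigma>} * (\<kappa> ^ card D * ?p {S. Q (\<sigma> \<union> (S \<inter> (Y - D)))})
        \<le> ?p {S. P (S \<inter> X) \<and> S \<inter> D = \<sigma>} * ?p {S. Q (S \<inter> Y)}"
      by (rule mult_left_mono) simp
    then show ?thesis unfolding 1 by (simp add: mult_ac)
  qed
  have dis: "(\<Sum>\<sigma>\<in>Pow D. ?p {S. P (S \<inter> X) \<and> S \<inter> D = \<sigma>}) = ?p {S. P (S \<inter> X)}"
  proof -
    have "{S. P (S \<inter> X)} = (\<Union>\<sigma>\<in>Pow D. {S. P (S \<inter> X) \<and> S \<inter> D = \<sigma>})"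
      by (rule set_eqI) simp
    moreover have "?p (\<Union>\<sigma>\<in>Pow D. {S. P (S \<inter> X) \<and> S \<inter> D = \<sigma>}) = (\<Sum>\<sigma>\<in>Pow D. ?p {S. P (S \<inter> X) \<and> S \<inter> D = \<sigma>})"
      by (rule measure_pmf.finite_measure_finite_Union) (use finD in \<open>auto simp only: disjoint_family_on_def finite_Pow_iff sets_measure_pmf image_subset_iff\<close>)
    ultimately show ?thesis by simp
  qed
  have "?p {S. P (S \<inter> X) \<and> Q (S \<inter> Y)} \<le> (\<Sum>\<sigma>\<in>Pow D. ?p {S. P (S \<inter> X) \<and> Q (S \<inter> Y) \<and> S \<inter> D = \<sigma>})"
    by (rule pmf_union_bound) (use finD in auto)
  then have "\<kappa> ^ card D * ?p {S. P (S \<inter> X) \<and> Q (S \<inter> Y)}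
      \<le> \<kappa> ^ card D * (\<Sum>\<sigma>\<in>Pow D. ?p {S. P (S \<inter> X) \<and> Q (S \<inter> Y) \<and> S \<inter> D = \<sigma>})"
    by (rule mult_left_mono) (use \<kappa> in simp)
  also have "\<dots> \<le> (\<Sum>\<sigma>\<in>Pow D. ?p {S. P (S \<inter> X) \<and> S \<inter> D = \<sigma>} * ?p {S. Q (S \<inter> Y)})"
    unfolding sum_distrib_left using cond by (intro sum_mono) auto
  also have "\<dots> = ?p {S. P (S \<inter> X)} * ?p {S. Q (S \<inter> Y)}"
    unfolding sum_distrib_right[symmetric] dis ..
  finally show ?thesis unfolding D_def .
qed

section \<open>A Chernoff bound for the binomial distribution\<close>

lemma exp_le_quadratic:
  fixes t :: real
  assumes "\<bar>t\<bar> \<le> 1"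
  shows "exp t \<le> 1 + t + t\<^sup>2"
proof (cases "0 \<le> t")
  case True
  then show ?thesis using exp_bound[of t] assms by simp
next
  case False
  have "exp t = 1 / exp (- t)" by (simp add: exp_minus field_simps)
  also have "\<dots> \<le> 1 / (1 + (- t))"
    using False exp_ge_add_one_self[of "- t"] by (intro divide_left_mono) auto
  also have "\<dots> \<le> 1 + t + t\<^sup>2"
  proof -
    \<comment> \<open>The product is 1 - t^3, and t is negative here.\<close>
    have "1 \<le> (1 + t + t\<^sup>2) * (1 - t)"
      using False assms by (simp add: algebra_simps power2_eq_square mult_nonpos_nonneg)
    then show ?thesis using False by (simp add: field_simps)
  qed
  finally show ?thesis .
qed

text \<open>The binomial theorem gives the moment generating function (q exp t + 1 - q)^N; then exp
  t \<le> 1 + t + t^2 and 1 + y \<le> exp y.\<close>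

lemma binomial_exp_moment:
  fixes q t :: real
  assumes q: "0 \<le> q" "q \<le> 1" and t: "\<bar>t\<bar> \<le> 1"
  shows "measure_pmf.expectation (binomial_pmf N q) (\<lambda>k. exp (t * (real k - N * q))) \<le> exp (N * q * t\<^sup>2)"
proof -
  have "measure_pmf.expectation (binomial_pmf N q) (\<lambda>k. exp (t * (real k - N * q)))
      = (\<Sum>k\<le>N. (real (N choose k) * q ^ k * (1 - q) ^ (N - k)) * exp (t * (real k - N * q)))"
    using q by (subst expectation_binomial_pmf') auto
  also have "\<dots> = exp (- t * (N * q)) * (\<Sum>k\<le>N. real (N choose k) * (q * exp t) ^ k * (1 - q) ^ (N - k))"
    unfolding sum_distrib_left
    by (intro sum.cong refl) (simp add: power_mult_distrib exp_of_nat_mult[symmetric] right_diff_distrib exp_diff exp_minus field_simps)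
  also have "\<dots> = exp (- t * (N * q)) * (q * exp t + (1 - q)) ^ N"
    unfolding binomial_ring by simp
  also have "\<dots> \<le> exp (- t * (N * q)) * exp (N * (q * t + q * t\<^sup>2))"
  proof (rule mult_left_mono)
    have "q * exp t \<le> q * (1 + t + t\<^sup>2)"
      by (rule mult_left_mono[OF exp_le_quadratic[OF t] q(1)])
    then have "q * exp t + (1 - q) \<le> 1 + (q * t + q * t\<^sup>2)" by (simp add: algebra_simps)
    also have "\<dots> \<le> exp (q * t + q * t\<^sup>2)" by (rule exp_ge_add_one_self)
    finally have "(q * exp t + (1 - q)) ^ N \<le> exp (q * t + q * t\<^sup>2) ^ N"
      using q by (intro power_mono) auto
    then show "(q * exp t + (1 - q)) ^ N \<le> exp (N * (q * t + q * t\<^sup>2))"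
      by (simp add: exp_of_nat_mult)
  qed simp
  also have "\<dots> = exp (N * q * t\<^sup>2)"
    by (simp add: exp_add[symmetric] algebra_simps)
  finally show ?thesis .
qed

text \<open>Markov's inequality for the exponential moment leaves the exponent qN (t^2 - x |t|),
  which |t| = x/2 minimises; x \<le> 2 keeps |t| \<le> 1. The sign of t selects the tail.\<close>

lemma binomial_chernoff:
  fixes q x :: real
  assumes q: "0 \<le> q" "q \<le> 1" and x: "0 < x" "x \<le> 2"
  shows "measure_pmf.prob (binomial_pmf N q) {k. x * (q * N) < \<bar>real k - q * N\<bar>} \<le> 2 * exp (- (x\<^sup>2 * (q * N) / 4))"
proof -
  let ?P = "binomial_pmf N q"
  have tail: "measure_pmf.prob ?P {k. x / 2 * (x * (q * N)) \<le> t * (real k - N * q)} \<le> exp (- (x\<^sup>2 * (q * N) / 4))"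
    if t: "\<bar>t\<bar> = x / 2" for t
  proof -
    let ?f = "\<lambda>k::nat. exp (t * (real k - N * q))"
    have "measure_pmf.prob ?P {k. x / 2 * (x * (q * N)) \<le> t * (real k - N * q)}
        = measure_pmf.prob ?P {k \<in> space (measure_pmf ?P). exp (x / 2 * (x * (q * N))) \<le> ?f k}"
      by simp
    also have "\<dots> \<le> measure_pmf.expectation ?P ?f / exp (x / 2 * (x * (q * N)))"
    proof (rule integral_Markov_inequality_measure[where A = "{}"])
      show "integrable (measure_pmf ?P) ?f"
        by (rule integrable_measure_pmf_finite) (use q in auto)
    qed (use q in auto)
    also have "\<dots> \<le> exp (N * q * t\<^sup>2) / exp (x / 2 * (x * (q * N)))"
      using binomial_exp_moment[OF q, of t N] t x by (intro divide_right_mono) auto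
    also have "\<dots> = exp (- (x\<^sup>2 * (q * N) / 4))"
    proof -
      have "t\<^sup>2 = (x / 2)\<^sup>2" by (metis t power2_abs)
      then show ?thesis by (simp add: exp_diff[symmetric] power2_eq_square field_simps)
    qed
    finally show ?thesis .
  qed
  have "measure_pmf.prob ?P {k. x * (q * N) < \<bar>real k - q * N\<bar>}
     \<le> (\<Sum>t\<in>{x/2, - (x/2)}. measure_pmf.prob ?P {k. x / 2 * (x * (q * N)) \<le> t * (real k - N * q)})"
  proof (rule pmf_union_bound)
    fix k :: nat assume "x * (q * N) < \<bar>real k - q * N\<bar>"
    then have "x / 2 * (x * (q * N)) \<le> x / 2 * \<bar>real k - N * q\<bar>"
      using x by (intro mult_left_mono) (auto simp: mult.commute)
    moreover have "x / 2 * \<bar>real k - N * q\<bar> = x / 2 * (real k - N * q) \<or> x / 2 * \<bar>real k - N * q\<bar> = - (x / 2) * (real k - N * q)"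
      by (metis abs_if mult_minus_left mult_minus_right)
    ultimately show "\<exists>t\<in>{x/2, - (x/2)}. x / 2 * (x * (q * N)) \<le> t * (real k - N * q)" by auto
  qed simp
  also have "\<dots> \<le> 2 * exp (- (x\<^sup>2 * (q * N) / 4))"
    using tail[of "x/2"] tail[of "- (x/2)"] x by (simp del: times_divide_eq_left)
  finally show ?thesis .
qed

section \<open>Common neighbours in the random graph\<close>

lemma set_random_graph: "graphs_deg n dd \<noteq> {} \<Longrightarrow> set_pmf (random_graph n dd) = graphs_deg n dd"
  unfolding random_graph_def using finite_graphs_deg by simp

lemma sum_squares_le:
  fixes dd :: "nat \<Rightarrow> nat"
  assumes "\<And>i. i \<in> I \<Longrightarrow> dd i \<le> D"
  shows "(\<Sum>i\<in>I. (real (dd i))\<^sup>2) \<le> real D * real (\<Sum>i\<in>I. dd i)"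
  unfolding of_nat_sum sum_distrib_left power2_eq_square
  by (intro sum_mono mult_right_mono) (use assms in auto)

text \<open>For distinct u and v this says that the closed neighbourhoods meet, without which the
  two degree events are independent given the graph.\<close>

definition overlap :: "nat set set \<Rightarrow> nat \<Rightarrow> nat \<Rightarrow> bool" where
  "overlap E u v \<longleftrightarrow> {u, v} \<in> E \<or> nb E u \<inter> nb E v \<noteq> {}"

text \<open>Two common neighbours give a 4-cycle, an edge with a common neighbour gives a triangle,
  and both have probability of order M^-2. Outside these cases the closed neighbourhoods of distinct
  vertices share at most two vertices. The 4-cycle case also takes in non-adjacent pairs that share
  exactly two.\<close>

definition overlap2 :: "nat set set \<Rightarrow> nat \<Rightarrow> nat \<Rightarrow> bool" where
  "overlap2 E u v \<longleftrightarrow> (\<exists>w\<in>nb E u \<inter> nb E v. \<exists>w'\<in>nb E u \<inter> nb E v. w \<noteq> w') \<or> {u, v} \<in> E \<and> nb E u \<inter> nb E v \<noteq> {}"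

context
  fixes n :: nat and dd :: "nat \<Rightarrow> nat" and D :: nat and M :: real
  assumes ne: "graphs_deg n dd \<noteq> {}"
    and D: "\<And>i. i \<in> {1..n} \<Longrightarrow> dd i \<le> D" "1 \<le> D"
    and big: "20 * D\<^sup>2 \<le> (\<Sum>i=1..n. dd i)"
    and M: "M = real (\<Sum>i=1..n. dd i)"
begin

lemma degree_sum_pos: "0 < M"
proof -
  have "1 \<le> D\<^sup>2" using D(2) by simp
  then have "0 < (\<Sum>i=1..n. dd i)" using big by linarith
  then show ?thesis unfolding M by (simp del: of_nat_sum)
qed

lemma prob_edge:
  assumes "u \<in> {1..n}" "v \<in> {1..n}"
  shows "measure_pmf.prob (random_graph n dd) {E. {u, v} \<in> E} \<le> 2 * real (dd u) * real (dd v) / M"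
  using prob_insert_edge[OF ne _ _ _ assms D big, of "{}"] by (simp add: M)

lemma prob_add_edge:
  assumes "u \<in> {1..n}" "v \<in> {1..n}" "finite H" "card H \<le> 3" "{u, v} \<notin> H"
    and "measure_pmf.prob (random_graph n dd) {E. H \<subseteq> E} \<le> b"
  shows "measure_pmf.prob (random_graph n dd) {E. insert {u, v} H \<subseteq> E} \<le> 2 * real (dd u) * real (dd v) / M * b"
proof -
  have "measure_pmf.prob (random_graph n dd) {E. insert {u, v} H \<subseteq> E}
      \<le> 2 * real (dd u) * real (dd v) / M * measure_pmf.prob (random_graph n dd) {E. H \<subseteq> E}"
    using prob_insert_edge[OF ne assms(3-5,1,2) D big] unfolding M by simp
  also have "\<dots> \<le> 2 * real (dd u) * real (dd v) / M * b"
    using assms(6) degree_sum_pos by (intro mult_left_mono) auto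
  finally show ?thesis .
qed

lemma prob_path:
  assumes "u \<in> {1..n}" "v \<in> {1..n}" "w \<in> {1..n}" "u \<noteq> v"
  shows "measure_pmf.prob (random_graph n dd) {E. {{u, w}, {v, w}} \<subseteq> E}
    \<le> 4 * real (dd u) * real (dd v) * (real (dd w))\<^sup>2 / M\<^sup>2"
proof -
  have "measure_pmf.prob (random_graph n dd) {E. {{u, w}, {v, w}} \<subseteq> E}
     \<le> 2 * real (dd u) * real (dd w) / M * (2 * real (dd v) * real (dd w) / M)"
    using assms prob_edge[of v w] by (intro prob_add_edge) (auto simp: doubleton_eq_iff)
  then show ?thesis by (simp add: power2_eq_square mult_ac)
qed

text \<open>The union over the middle vertex w produces the sum of d(w)^2, which is at most D M and
  so cancels one of the two factors 1/M.\<close>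

lemma prob_common_nb:
  assumes "u \<in> {1..n}" "v \<in> {1..n}" "u \<noteq> v"
  shows "measure_pmf.prob (random_graph n dd) {E. nb E u \<inter> nb E v \<noteq> {}}
    \<le> 4 * real (dd u) * real (dd v) * D / M"
proof -
  have "measure_pmf.prob (random_graph n dd) {E. nb E u \<inter> nb E v \<noteq> {}}
    \<le> (\<Sum>w\<in>{1..n}. measure_pmf.prob (random_graph n dd) {E. {{u, w}, {v, w}} \<subseteq> E})"
  proof (rule pmf_union_bound)
    fix E assume "E \<in> set_pmf (random_graph n dd)" "nb E u \<inter> nb E v \<noteq> {}"
    then obtain w where "w \<in> nb E u" "w \<in> nb E v" and E: "E \<in> graphs_deg n dd"
      by (auto simp: set_random_graph[OF ne])
    moreover have "w \<in> {1..n}" using nb_subset[OF E, of u] calculation by blast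
    ultimately have "w \<in> {1..n}" "w \<in> nb E u" "w \<in> nb E v" by auto
    then show "\<exists>w\<in>{1..n}. {{u, w}, {v, w}} \<subseteq> E" by (auto simp: nb_def insert_commute)
  qed simp
  also have "\<dots> \<le> (\<Sum>w\<in>{1..n}. 4 * real (dd u) * real (dd v) * (real (dd w))\<^sup>2 / M\<^sup>2)"
    using assms by (intro sum_mono prob_path) auto
  also have "\<dots> = 4 * real (dd u) * real (dd v) / M\<^sup>2 * (\<Sum>w\<in>{1..n}. (real (dd w))\<^sup>2)"
    by (simp add: sum_distrib_left)
  also have "\<dots> \<le> 4 * real (dd u) * real (dd v) / M\<^sup>2 * (real D * M)"
    unfolding M using D by (intro mult_left_mono sum_squares_le) auto
  also have "\<dots> = 4 * real (dd u) * real (dd v) * D / M"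
    using degree_sum_pos by (simp add: power2_eq_square)
  finally show ?thesis .
qed

lemma prob_overlap:
  assumes "u \<in> {1..n}" "v \<in> {1..n}" "u \<noteq> v"
  shows "measure_pmf.prob (random_graph n dd) {E. overlap E u v} \<le> 6 * real (dd u) * real (dd v) * D / M"
proof -
  have "measure_pmf.prob (random_graph n dd) {E. overlap E u v}
     \<le> measure_pmf.prob (random_graph n dd) ({E. {u, v} \<in> E} \<union> {E. nb E u \<inter> nb E v \<noteq> {}})"
    by (rule measure_pmf.finite_measure_mono) (auto simp: overlap_def)
  also have "\<dots> \<le> measure_pmf.prob (random_graph n dd) {E. {u, v} \<in> E}
      + measure_pmf.prob (random_graph n dd) {E. nb E u \<inter> nb E v \<noteq> {}}"
    by (rule measure_Un_le) auto
  also have "\<dots> \<le> 2 * real (dd u) * real (dd v) / M + 4 * real (dd u) * real (dd v) * D / M"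
    by (intro add_mono prob_edge prob_common_nb assms)
  also have "\<dots> \<le> 2 * real (dd u) * real (dd v) * D / M + 4 * real (dd u) * real (dd v) * D / M"
  proof -
    have "2 * real (dd u) * real (dd v) * 1 \<le> 2 * real (dd u) * real (dd v) * D"
      using D(2) by (intro mult_left_mono) auto
    then show ?thesis using degree_sum_pos by (intro add_right_mono divide_right_mono) auto
  qed
  finally show ?thesis by (simp add: mult_ac)
qed

text \<open>The largest configuration: its last edge is inserted over three others, which is why
  \<open>H\<close> may have up to three edges in the switching.\<close>

lemma prob_two_paths:
  assumes uv: "u \<in> {1..n}" "v \<in> {1..n}" "u \<noteq> v"
    and w: "w \<in> {1..n}" "w' \<in> {1..n}" "w \<noteq> w'" "w \<notin> {u, v}" "w' \<notin> {u, v}"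
  shows "measure_pmf.prob (random_graph n dd) {E. {{u, w}, {v, w}, {u, w'}, {v, w'}} \<subseteq> E}
    \<le> 16 * (real (dd u))\<^sup>2 * (real (dd v))\<^sup>2 / M ^ 4 * ((real (dd w))\<^sup>2 * (real (dd w'))\<^sup>2)"
proof -
  have "measure_pmf.prob (random_graph n dd) {E. {{u, w}, {v, w}, {u, w'}, {v, w'}} \<subseteq> E}
     \<le> 2 * real (dd u) * real (dd w) / M * (2 * real (dd v) * real (dd w) / M
        * (4 * real (dd u) * real (dd v) * (real (dd w'))\<^sup>2 / M\<^sup>2))"
    using uv w prob_path[of u v w'] by (intro prob_add_edge) (auto simp: doubleton_eq_iff card_insert_if)
  then show ?thesis by (simp add: power2_eq_square power4_eq_xxxx mult_ac)
qed

lemma prob_triangle: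
  assumes uv: "u \<in> {1..n}" "v \<in> {1..n}" "u \<noteq> v" and w: "w \<in> {1..n}" "w \<notin> {u, v}"
  shows "measure_pmf.prob (random_graph n dd) {E. {{u, v}, {u, w}, {v, w}} \<subseteq> E}
    \<le> 8 * (real (dd u))\<^sup>2 * (real (dd v))\<^sup>2 / M ^ 3 * (real (dd w))\<^sup>2"
proof -
  have "measure_pmf.prob (random_graph n dd) {E. {{u, v}, {u, w}, {v, w}} \<subseteq> E}
     \<le> 2 * real (dd u) * real (dd v) / M
        * (4 * real (dd u) * real (dd v) * (real (dd w))\<^sup>2 / M\<^sup>2)"
    using uv w prob_path[of u v w] by (intro prob_add_edge) (auto simp: doubleton_eq_iff card_insert_if)
  then show ?thesis by (simp add: power2_eq_square power3_eq_cube mult_ac)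
qed

lemma prob_overlap2:
  assumes uv: "u \<in> {1..n}" "v \<in> {1..n}" "u \<noteq> v"
  shows "measure_pmf.prob (random_graph n dd) {E. overlap2 E u v}
    \<le> 24 * (real (dd u))\<^sup>2 * (real (dd v))\<^sup>2 * D\<^sup>2 / M\<^sup>2"
proof -
  let ?P = "measure_pmf.prob (random_graph n dd)"
  \<comment> \<open>A common neighbour is neither u nor v; leaving these out keeps the edges of each
    configuration distinct, as successive insertion requires.\<close>
  define W where "W = {1..n} - {u, v}"
  define c where "c = (real (dd u))\<^sup>2 * (real (dd v))\<^sup>2"
  have c0: "0 \<le> c" unfolding c_def by simp
  have sq: "(\<Sum>w\<in>W. (real (dd w))\<^sup>2) \<le> D * M"
  proof -
    have "(\<Sum>w\<in>W. (real (dd w))\<^sup>2) \<le> (\<Sum>w\<in>{1..n}. (real (dd w))\<^sup>2)"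
      unfolding W_def by (intro sum_mono2) auto
    also have "\<dots> \<le> D * M" unfolding M using D by (intro sum_squares_le) auto
    finally show ?thesis .
  qed
  have sq0: "0 \<le> (\<Sum>w\<in>W. (real (dd w))\<^sup>2)" by (intro sum_nonneg) auto
  have nbW: "nb E u \<inter> nb E v \<subseteq> W" if "E \<in> set_pmf (random_graph n dd)" for E
    using that nb_subset[of E n dd u] nb_subset[of E n dd v] unfolding W_def
    by (auto simp: set_random_graph[OF ne])
  define W2 where "W2 = {(w, w') \<in> W \<times> W. w \<noteq> w'}"
  have finW: "finite W" "finite W2" unfolding W2_def W_def
    by (auto intro: finite_subset[of _ "({1..n} - {u, v}) \<times> ({1..n} - {u, v})"])
  have "?P {E. \<exists>w\<in>nb E u \<inter> nb E v. \<exists>w'\<in>nb E u \<inter> nb E v. w \<noteq> w'}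
      \<le> (\<Sum>z\<in>W2. ?P {E. {{u, fst z}, {v, fst z}, {u, snd z}, {v, snd z}} \<subseteq> E})"
  proof (rule pmf_union_bound[OF finW(2)])
    fix E assume E: "E \<in> set_pmf (random_graph n dd)"
      and "\<exists>w\<in>nb E u \<inter> nb E v. \<exists>w'\<in>nb E u \<inter> nb E v. w \<noteq> w'"
    then obtain w w' where "w \<in> nb E u \<inter> nb E v" "w' \<in> nb E u \<inter> nb E v" "w \<noteq> w'" by blast
    then show "\<exists>z\<in>W2. {{u, fst z}, {v, fst z}, {u, snd z}, {v, snd z}} \<subseteq> E"
      using nbW[OF E] unfolding W2_def by (intro bexI[of _ "(w, w')"]) (auto simp: nb_def insert_commute)
  qed
  also have "\<dots> \<le> (\<Sum>z\<in>W2. 16 * c / M ^ 4 * ((real (dd (fst z)))\<^sup>2 * (real (dd (snd z)))\<^sup>2))"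
  proof (rule sum_mono)
    fix z assume "z \<in> W2"
    then show "?P {E. {{u, fst z}, {v, fst z}, {u, snd z}, {v, snd z}} \<subseteq> E}
        \<le> 16 * c / M ^ 4 * ((real (dd (fst z)))\<^sup>2 * (real (dd (snd z)))\<^sup>2)"
      using prob_two_paths[OF uv, of "fst z" "snd z"] unfolding W2_def W_def c_def by (auto simp: mult_ac)
  qed
  \<comment> \<open>Adding the diagonal back lets the double sum factor.\<close>
  also have "\<dots> \<le> (\<Sum>z\<in>W \<times> W. 16 * c / M ^ 4 * ((real (dd (fst z)))\<^sup>2 * (real (dd (snd z)))\<^sup>2))"
    using c0 finW degree_sum_pos by (intro sum_mono2) (auto simp: W2_def)
  also have "\<dots> = 16 * c / M ^ 4 * ((\<Sum>w\<in>W. (real (dd w))\<^sup>2) * (\<Sum>w\<in>W. (real (dd w))\<^sup>2))"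
    by (subst sum_product) (simp only: sum_distrib_left sum.cartesian_product case_prod_unfold)
  also have "\<dots> \<le> 16 * c / M ^ 4 * ((D * M) * (D * M))"
    using sq sq0 c0 degree_sum_pos by (intro mult_left_mono mult_mono) auto
  also have "\<dots> = 16 * c * D\<^sup>2 / M\<^sup>2"
    using degree_sum_pos by (simp add: power2_eq_square power4_eq_xxxx)
  finally have A: "?P {E. \<exists>w\<in>nb E u \<inter> nb E v. \<exists>w'\<in>nb E u \<inter> nb E v. w \<noteq> w'} \<le> 16 * c * D\<^sup>2 / M\<^sup>2" .
  have "?P {E. {u, v} \<in> E \<and> nb E u \<inter> nb E v \<noteq> {}} \<le> (\<Sum>w\<in>W. ?P {E. {{u, v}, {u, w}, {v, w}} \<subseteq> E})"
  proof (rule pmf_union_bound[OF finW(1)])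
    fix E assume E: "E \<in> set_pmf (random_graph n dd)" and *: "{u, v} \<in> E \<and> nb E u \<inter> nb E v \<noteq> {}"
    then obtain w where "w \<in> nb E u \<inter> nb E v" by blast
    then show "\<exists>w\<in>W. {{u, v}, {u, w}, {v, w}} \<subseteq> E"
      using nbW[OF E] * by (intro bexI[of _ w]) (auto simp: nb_def insert_commute)
  qed
  also have "\<dots> \<le> (\<Sum>w\<in>W. 8 * c / M ^ 3 * (real (dd w))\<^sup>2)"
  proof (rule sum_mono)
    fix w assume "w \<in> W"
    then show "?P {E. {{u, v}, {u, w}, {v, w}} \<subseteq> E} \<le> 8 * c / M ^ 3 * (real (dd w))\<^sup>2"
      using prob_triangle[OF uv, of w] unfolding W_def c_def by (auto simp: mult_ac)
  qed
  also have "\<dots> = 8 * c / M ^ 3 * (\<Sum>w\<in>W. (real (dd w))\<^sup>2)" by (simp add: sum_distrib_left)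
  also have "\<dots> \<le> 8 * c / M ^ 3 * (D * M)" using sq c0 degree_sum_pos by (intro mult_left_mono) auto
  also have "\<dots> = 8 * c / M\<^sup>2 * D" using degree_sum_pos by (simp add: power2_eq_square power3_eq_cube)
  also have "\<dots> \<le> 8 * c / M\<^sup>2 * D\<^sup>2"
    using D(2) c0 degree_sum_pos by (intro mult_left_mono) (auto simp: power2_eq_square simp flip: of_nat_mult)
  finally have B: "?P {E. {u, v} \<in> E \<and> nb E u \<inter> nb E v \<noteq> {}} \<le> 8 * c * D\<^sup>2 / M\<^sup>2" by simp
  have "?P {E. overlap2 E u v} \<le> ?P ({E. \<exists>w\<in>nb E u \<inter> nb E v. \<exists>w'\<in>nb E u \<inter> nb E v. w \<noteq> w'}
      \<union> {E. {u, v} \<in> E \<and> nb E u \<inter> nb E v \<noteq> {}})"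
    by (rule measure_pmf.finite_measure_mono) (auto simp: overlap2_def)
  also have "\<dots> \<le> ?P {E. \<exists>w\<in>nb E u \<inter> nb E v. \<exists>w'\<in>nb E u \<inter> nb E v. w \<noteq> w'}
      + ?P {E. {u, v} \<in> E \<and> nb E u \<inter> nb E v \<noteq> {}}"
    by (rule measure_Un_le) auto
  also have "\<dots> \<le> 16 * c * D\<^sup>2 / M\<^sup>2 + 8 * c * D\<^sup>2 / M\<^sup>2" by (rule add_mono[OF A B])
  also have "\<dots> = 24 * (real (dd u))\<^sup>2 * (real (dd v))\<^sup>2 * D\<^sup>2 / M\<^sup>2"
    unfolding c_def by (simp add: mult_ac)
  finally show ?thesis .
qed

end


section \<open>Concentration of degree counts\<close>

lemma degS_conv_nb: "degS E S v = card (S \<inter> nb E v)"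
  unfolding degS_def nb_def by (rule arg_cong[where f = card]) auto

lemma prob_degS:
  assumes E: "E \<in> graphs_deg n dd" and v: "v \<in> {1..n}" and q: "0 \<le> q" "q \<le> 1"
  shows "measure_pmf.prob (random_subset n q) {S. P (degS E S v)}
    = measure_pmf.prob (binomial_pmf (dd v) q) {k. P k}"
  unfolding degS_conv_nb random_subset_conv_bern
  using prob_bern_subset_card[of "{1..n}" "nb E v" q P] nb_subset[OF E, of v] q card_nb[OF E v] by auto

definition deg_event :: "nat \<Rightarrow> nat \<Rightarrow> nat set set \<times> nat set \<Rightarrow> bool" where
  "deg_event i v z \<longleftrightarrow> v \<in> snd z \<and> degS (fst z) (snd z) v = i"

text \<open>Locality puts the event into the form required by the independence and overlap bounds
  for random subsets.\<close>

lemma deg_event_local: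
  "deg_event i v (E, S) \<longleftrightarrow> deg_event i v (E, S \<inter> insert v (nb E v))"
proof -
  have "S \<inter> insert v (nb E v) \<inter> nb E v = S \<inter> nb E v" by blast
  then show ?thesis unfolding deg_event_def degS_conv_nb by simp
qed

text \<open>As v is not its own neighbour, its membership is independent of its degree into S. The
  graph enters only through \<open>dd v\<close>, so the value is the same for every graph.\<close>

lemma prob_deg_event:
  assumes E: "E \<in> graphs_deg n dd" and v: "v \<in> {1..n}" and q: "0 \<le> q" "q \<le> 1"
  shows "measure_pmf.prob (random_subset n q) {S. deg_event i v (E, S)} = q * pmf (binomial_pmf (dd v) q) i"
proof -
  have "measure_pmf.prob (random_subset n q) {S. deg_event i v (E, S)}
      = measure_pmf.prob (bern_subset {1..n} q) {S. S \<inter> {v} = {v} \<and> card (S \<inter> nb E v) = i}"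
    unfolding deg_event_def degS_conv_nb random_subset_conv_bern by (rule pmf_prob_cong) auto
  also have "\<dots> = measure_pmf.prob (bern_subset {1..n} q) {S. S \<inter> {v} = {v}}
      * measure_pmf.prob (bern_subset {1..n} q) {S. card (S \<inter> nb E v) = i}"
    by (rule bern_subset_indep) (use nb_subset[OF E, of v] v in auto)
  also have "{S. S \<inter> {v} = {v}} = {S. v \<in> S}" by auto
  also have "measure_pmf.prob (bern_subset {1..n} q) {S. v \<in> S} = q"
    using v q by (intro prob_bern_subset_mem) auto
  also have "measure_pmf.prob (bern_subset {1..n} q) {S. card (S \<inter> nb E v) = i} = pmf (binomial_pmf (dd v) q) i"
    using prob_degS[OF E v q, of "\<lambda>k. k = i"]
    by (simp add: degS_conv_nb random_subset_conv_bern measure_pmf_single)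
  finally show ?thesis .
qed

lemma prob_deg_event_pair:
  fixes i :: nat
  assumes E: "E \<in> graphs_deg n dd" and u: "u \<in> {1..n}" and v: "v \<in> {1..n}" and uv: "u \<noteq> v"
    and \<kappa>: "0 < \<kappa>" "\<kappa> \<le> q" "\<kappa> \<le> 1 - q"
  defines "a \<equiv> \<lambda>w. q * pmf (binomial_pmf (dd w) q) i"
  shows "measure_pmf.prob (random_subset n q) {S. deg_event i u (E, S) \<and> deg_event i v (E, S)}
    \<le> a u * a v + a u * a v / \<kappa>\<^sup>2 * of_bool (overlap E u v) + a u * of_bool (overlap2 E u v)"
proof -
  let ?p = "measure_pmf.prob (random_subset n q)"
  let ?N = "\<lambda>w. insert w (nb E w)"
  have q: "0 \<le> q" "q \<le> 1" using \<kappa> by auto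
  have a0: "0 \<le> a w" for w unfolding a_def using q by simp
  have pa: "?p {S. deg_event i w (E, S)} = a w" if "w \<in> {1..n}" for w
    unfolding a_def by (rule prob_deg_event[OF E that q])
  show ?thesis
  proof (cases "overlap2 E u v")
    case True
    have "?p {S. deg_event i u (E, S) \<and> deg_event i v (E, S)} \<le> ?p {S. deg_event i u (E, S)}"
      by (rule pmf_prob_mono) auto
    also have "\<dots> = a u" by (rule pa[OF u])
    finally show ?thesis using True a0[of u] a0[of v] by (simp add: add_increasing)
  next
    case False
    have "\<kappa> ^ card (?N u \<inter> ?N v) * measure_pmf.prob (bern_subset {1..n} q)
        {S. deg_event i u (E, S \<inter> ?N u) \<and> deg_event i v (E, S \<inter> ?N v)}
      \<le> measure_pmf.prob (bern_subset {1..n} q) {S. deg_event i u (E, S \<inter> ?N u)}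
        * measure_pmf.prob (bern_subset {1..n} q) {S. deg_event i v (E, S \<inter> ?N v)}"
      by (rule bern_subset_overlap)
         (use nb_subset[OF E, of u] nb_subset[OF E, of v] u v \<kappa> in auto)
    then have *: "\<kappa> ^ card (?N u \<inter> ?N v) * ?p {S. deg_event i u (E, S) \<and> deg_event i v (E, S)} \<le> a u * a v"
      unfolding deg_event_local[symmetric] random_subset_conv_bern[symmetric] pa[OF u] pa[OF v] .
    have vu: "v \<in> nb E u \<longleftrightarrow> {u, v} \<in> E" "u \<in> nb E v \<longleftrightarrow> {u, v} \<in> E"
      unfolding nb_def by (auto simp: insert_commute)
    show ?thesis
    proof (cases "overlap E u v")
      case ov: False
      then have "?N u \<inter> ?N v = {}" using uv vu unfolding overlap_def by auto
      with * show ?thesis using ov False by simp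
    next
      case ov: True
      \<comment> \<open>Adjacent u, v share only themselves, having no common neighbour here;
        non-adjacent ones share exactly one common neighbour.\<close>
      have "card (?N u \<inter> ?N v) \<le> 2"
      proof (cases "{u, v} \<in> E")
        case True
        then have "?N u \<inter> ?N v \<subseteq> {u, v}" using False unfolding overlap2_def by auto
        then have "card (?N u \<inter> ?N v) \<le> card {u, v}" by (intro card_mono) auto
        then show ?thesis using uv by simp
      next
        case nadj: False
        then have "?N u \<inter> ?N v = nb E u \<inter> nb E v" using uv vu by auto
        moreover from ov nadj obtain w where "w \<in> nb E u \<inter> nb E v" unfolding overlap_def by auto
        then have "nb E u \<inter> nb E v = {w}" using False unfolding overlap2_def by blast
        ultimately show ?thesis by simp
      qed
      then have "\<kappa>\<^sup>2 \<le> \<kappa> ^ card (?N u \<inter> ?N v)" using \<kappa> q by (intro power_decreasing) auto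
      then have "\<kappa>\<^sup>2 * ?p {S. deg_event i u (E, S) \<and> deg_event i v (E, S)} \<le> a u * a v"
        by (intro order_trans[OF mult_right_mono *]) auto
      then have "?p {S. deg_event i u (E, S) \<and> deg_event i v (E, S)} \<le> a u * a v / \<kappa>\<^sup>2"
        using \<kappa> by (simp add: field_simps)
      then show ?thesis using ov False a0[of u] a0[of v] by (simp add: add_increasing)
    qed
  qed
qed

text \<open>The variance has three parts: the diagonal, at most m; the typical overlaps, giving the
  quadratic term; and the pairs with \<open>overlap2\<close>. The last part carries a factor
  \<open>card L\<close>, but \<open>card L\<close> \<le> n \<le> M and \<open>small\<close> reduce
  it to another m.\<close>

lemma deg_count_concentration:
  fixes dd :: "nat \<Rightarrow> nat" and D i :: nat and M C q \<kappa> t :: real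
  assumes ne: "graphs_deg n dd \<noteq> {}"
    and D: "\<And>i. i \<in> {1..n} \<Longrightarrow> dd i \<le> D" "1 \<le> D"
    and big: "20 * D\<^sup>2 \<le> (\<Sum>i=1..n. dd i)"
    and M: "M = real (\<Sum>i=1..n. dd i)" and nM: "real n \<le> M"
    and \<kappa>: "0 < \<kappa>" "\<kappa> \<le> q" "\<kappa> \<le> 1 - q"
    and L: "L \<subseteq> {1..n}" "\<And>v. v \<in> L \<Longrightarrow> real (dd v) \<le> C"
    and small: "24 * C ^ 4 * (real D)\<^sup>2 \<le> M"
    and t: "0 < t"
  defines "m \<equiv> \<Sum>v\<in>L. q * pmf (binomial_pmf (dd v) q) i"
  shows "measure_pmf.prob (pair_pmf (random_graph n dd) (random_subset n q))
      {z. t < \<bar>(\<Sum>v\<in>L. of_bool (deg_event i v z)) - m\<bar>}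
    \<le> (2 * m + 6 * C\<^sup>2 * D / (M * \<kappa>\<^sup>2) * m\<^sup>2) / t\<^sup>2"
proof -
  define P where "P = measure_pmf.prob (pair_pmf (random_graph n dd) (random_subset n q))"
  define a where "a w = q * pmf (binomial_pmf (dd w) q) i" for w
  note ctx = ne D big M
  have M0: "0 < M" by (rule degree_sum_pos[OF ctx])
  have q: "0 \<le> q" "q \<le> 1" using \<kappa> by auto
  have a0: "0 \<le> a w" for w unfolding a_def using q by simp
  have finL: "finite L" using L finite_subset by blast
  have m: "m = (\<Sum>v\<in>L. a v)" unfolding m_def a_def ..
  have m0: "0 \<le> m" unfolding m using a0 by (simp add: sum_nonneg)
  have C0: "0 \<le> C" if "v \<in> L" for v using L(2)[OF that] by linarith
  \<comment> \<open>The conditional probability is constant in E, so the conditional means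
    contribute nothing to the covariances.\<close>
  have single: "P {z. deg_event i v z} = a v" if "v \<in> {1..n}" for v
  proof -
    have "P {z. deg_event i v z} = measure_pmf.expectation (random_graph n dd)
        (\<lambda>E. measure_pmf.prob (random_subset n q) {S. deg_event i v (E, S)})"
      unfolding P_def using prob_pair_pmf[of "random_graph n dd" "random_subset n q" "\<lambda>E S. deg_event i v (E, S)"]
      by (simp add: case_prod_unfold)
    also have "\<dots> = measure_pmf.expectation (random_graph n dd) (\<lambda>E. a v)"
      by (intro integral_cong_AE)
         (use prob_deg_event[OF _ that q] in \<open>auto simp: AE_measure_pmf_iff set_random_graph[OF ne] a_def\<close>)
    finally show ?thesis by simp
  qed
  have pair: "P {z. deg_event i u z \<and> deg_event i v z} - a u * a v
      \<le> 6 * C\<^sup>2 * D / (M * \<kappa>\<^sup>2) * (a u * a v) + 24 * C ^ 4 * D\<^sup>2 / M\<^sup>2 * a u"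
    if u: "u \<in> L" and v: "v \<in> L" and uv: "u \<noteq> v" for u v
  proof -
    have un: "u \<in> {1..n}" and vn: "v \<in> {1..n}" using u v L by auto
    have du: "0 \<le> real (dd u)" "real (dd u) \<le> C" "0 \<le> real (dd v)" "real (dd v) \<le> C" using L(2) u v by auto
    let ?X = "\<lambda>E. a u * a v + a u * a v / \<kappa>\<^sup>2 * indicator {E. overlap E u v} E + a u * indicator {E. overlap2 E u v} E"
    have ind: "integrable (measure_pmf (random_graph n dd)) (indicator X :: _ \<Rightarrow> real)" for X
      by (rule integrable_pmf_bounded[where B = 1]) (auto simp: indicator_def)
    have "P {z. deg_event i u z \<and> deg_event i v z} = measure_pmf.expectation (random_graph n dd)
        (\<lambda>E. measure_pmf.prob (random_subset n q) {S. deg_event i u (E, S) \<and> deg_event i v (E, S)})"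
      unfolding P_def using prob_pair_pmf[of "random_graph n dd" "random_subset n q" "\<lambda>E S. deg_event i u (E, S) \<and> deg_event i v (E, S)"]
      by (simp add: case_prod_unfold)
    also have "\<dots> \<le> measure_pmf.expectation (random_graph n dd) ?X"
    proof (rule integral_mono_AE)
      show "integrable (measure_pmf (random_graph n dd))
          (\<lambda>E. measure_pmf.prob (random_subset n q) {S. deg_event i u (E, S) \<and> deg_event i v (E, S)})"
        by (rule integrable_pmf_bounded[where B = 1]) auto
      show "AE E in measure_pmf (random_graph n dd).
          measure_pmf.prob (random_subset n q) {S. deg_event i u (E, S) \<and> deg_event i v (E, S)} \<le> ?X E"
        using prob_deg_event_pair[OF _ un vn uv \<kappa>, of _ dd i]
        by (auto simp: AE_measure_pmf_iff set_random_graph[OF ne] a_def indicator_def of_bool_def)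
      show "integrable (measure_pmf (random_graph n dd)) ?X"
        by (intro Bochner_Integration.integrable_add integrable_mult_right ind) auto
    qed
    also have "\<dots> = a u * a v + a u * a v / \<kappa>\<^sup>2 * measure_pmf.prob (random_graph n dd) {E. overlap E u v}
        + a u * measure_pmf.prob (random_graph n dd) {E. overlap2 E u v}"
      by (simp add: ind)
    also have "\<dots> \<le> a u * a v + a u * a v / \<kappa>\<^sup>2 * (6 * (C * C) * D / M) + a u * (24 * (C\<^sup>2 * C\<^sup>2) * D\<^sup>2 / M\<^sup>2)"
    proof (intro add_mono mult_left_mono order_refl)
      have "real (dd u) * real (dd v) \<le> C * C" using du by (intro mult_mono) auto
      then have "6 * (real (dd u) * real (dd v)) * D / M \<le> 6 * (C * C) * D / M"
        using M0 by (intro divide_right_mono mult_right_mono mult_left_mono) auto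
      then show "measure_pmf.prob (random_graph n dd) {E. overlap E u v} \<le> 6 * (C * C) * D / M"
        using prob_overlap[OF ctx un vn uv] by (simp add: mult_ac)
      have "(real (dd u))\<^sup>2 * (real (dd v))\<^sup>2 \<le> C\<^sup>2 * C\<^sup>2"
        using du by (intro mult_mono power_mono) auto
      then have "24 * ((real (dd u))\<^sup>2 * (real (dd v))\<^sup>2) * D\<^sup>2 / M\<^sup>2 \<le> 24 * (C\<^sup>2 * C\<^sup>2) * D\<^sup>2 / M\<^sup>2"
        by (intro divide_right_mono mult_right_mono mult_left_mono) auto
      then show "measure_pmf.prob (random_graph n dd) {E. overlap2 E u v} \<le> 24 * (C\<^sup>2 * C\<^sup>2) * D\<^sup>2 / M\<^sup>2"
        using prob_overlap2[OF ctx un vn uv] by (simp add: mult_ac)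
    qed (use a0 in auto)
    finally show ?thesis
      by (simp add: power2_eq_square power4_eq_xxxx mult_ac)
  qed
  have entry: "P {z. deg_event i u z \<and> deg_event i v z} - a u * a v
      \<le> of_bool (u = v) * a u + 6 * C\<^sup>2 * D / (M * \<kappa>\<^sup>2) * (a u * a v) + 24 * C ^ 4 * D\<^sup>2 / M\<^sup>2 * a u"
    if u: "u \<in> L" and v: "v \<in> L" for u v
  proof (cases "u = v")
    case True
    have "0 \<le> 6 * C\<^sup>2 * D / (M * \<kappa>\<^sup>2) * (a u * a v) + 24 * C ^ 4 * D\<^sup>2 / M\<^sup>2 * a u"
      using a0 M0 by simp
    moreover have "P {z. deg_event i u z \<and> deg_event i v z} = a u"
      using single[of u] u L True by auto
    moreover have "0 \<le> a u * a v" using a0 by simp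
    moreover have "of_bool (u = v) * a u = a u" using True by simp
    ultimately show ?thesis by linarith
  qed (use pair[OF u v] in simp)
  have "P {z. t < \<bar>(\<Sum>v\<in>L. 1 * of_bool (deg_event i v z)) - (\<Sum>v\<in>L. 1 * P {z. deg_event i v z})\<bar>}
    \<le> (\<Sum>u\<in>L. \<Sum>v\<in>L. 1 * 1 * (P {z. deg_event i u z \<and> deg_event i v z}
          - P {z. deg_event i u z} * P {z. deg_event i v z})) / t\<^sup>2"
    unfolding P_def by (rule pmf_weighted_chebyshev[OF finL t])
  also have "(\<Sum>v\<in>L. 1 * P {z. deg_event i v z}) = m"
    unfolding m using single L by (intro sum.cong) auto
  also have "(\<Sum>u\<in>L. \<Sum>v\<in>L. 1 * 1 * (P {z. deg_event i u z \<and> deg_event i v z}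
          - P {z. deg_event i u z} * P {z. deg_event i v z}))
      = (\<Sum>u\<in>L. \<Sum>v\<in>L. P {z. deg_event i u z \<and> deg_event i v z} - a u * a v)"
    using single L by (intro sum.cong refl) (auto simp: subset_iff)
  finally have cheb: "P {z. t < \<bar>(\<Sum>v\<in>L. of_bool (deg_event i v z)) - m\<bar>}
     \<le> (\<Sum>u\<in>L. \<Sum>v\<in>L. P {z. deg_event i u z \<and> deg_event i v z} - a u * a v) / t\<^sup>2" by simp
  have "(\<Sum>u\<in>L. \<Sum>v\<in>L. P {z. deg_event i u z \<and> deg_event i v z} - a u * a v)
     \<le> (\<Sum>u\<in>L. \<Sum>v\<in>L. of_bool (u = v) * a u + 6 * C\<^sup>2 * D / (M * \<kappa>\<^sup>2) * (a u * a v) + 24 * C ^ 4 * D\<^sup>2 / M\<^sup>2 * a u)"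
    using entry by (intro sum_mono) auto
  also have "\<dots> = m + 6 * C\<^sup>2 * D / (M * \<kappa>\<^sup>2) * m\<^sup>2 + 24 * C ^ 4 * D\<^sup>2 / M\<^sup>2 * m * card L"
  proof -
    have "(\<Sum>u\<in>L. \<Sum>v\<in>L. of_bool (u = v) * a u) = m"
      unfolding m using finL by (intro sum.cong refl) (simp add: of_bool_def if_distrib[of "\<lambda>x. x * _"] cong: if_cong)
    moreover have "(\<Sum>u\<in>L. \<Sum>v\<in>L. \<alpha> * (a u * a v)) = \<alpha> * m\<^sup>2" for \<alpha>
      unfolding m power2_eq_square sum_product by (simp only: sum_distrib_left)
    moreover have "(\<Sum>u\<in>L. \<Sum>v\<in>L. \<beta> * a u) = \<beta> * m * card L" for \<beta>
      unfolding m by (simp add: sum_distrib_left mult_ac)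
    ultimately show ?thesis by (simp only: sum.distrib)
  qed
  also have "\<dots> \<le> 2 * m + 6 * C\<^sup>2 * D / (M * \<kappa>\<^sup>2) * m\<^sup>2"
  proof -
    have "card L \<le> n" using card_mono[OF _ L(1)] by simp
    then have "24 * C ^ 4 * D\<^sup>2 / M\<^sup>2 * m * card L \<le> 24 * C ^ 4 * D\<^sup>2 / M\<^sup>2 * m * M"
      using nM m0 by (intro mult_left_mono) auto
    also have "\<dots> = 24 * C ^ 4 * D\<^sup>2 / M * m" using M0 by (simp add: power2_eq_square)
    also have "\<dots> \<le> 1 * m" using small m0 M0 by (intro mult_right_mono) (auto simp: field_simps)
    finally show ?thesis by simp
  qed
  finally show ?thesis using order_trans[OF cheb divide_right_mono] unfolding P_def by simp
qed

section \<open>The four estimates at a fixed size\<close>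

text \<open>Memberships are independent, so only the diagonal terms of the variance survive.\<close>

lemma random_subset_weight_deviation:
  fixes w :: "nat \<Rightarrow> real"
  assumes q: "0 \<le> q" "q \<le> 1" and t: "0 < t"
  shows "measure_pmf.prob (random_subset n q) {S. t < \<bar>(\<Sum>v\<in>S. w v) - q * (\<Sum>v=1..n. w v)\<bar>}
    \<le> q * (\<Sum>v=1..n. (w v)\<^sup>2) / t\<^sup>2"
proof -
  let ?P = "measure_pmf.prob (random_subset n q)"
  have one: "?P {S. v \<in> S} = q" if "v \<in> {1..n}" for v
    unfolding random_subset_conv_bern using prob_bern_subset_mem[of "{1..n}" v q] that q by simp
  have two: "?P {S. u \<in> S \<and> v \<in> S} = q * q" if uv: "u \<in> {1..n}" "v \<in> {1..n}" "u \<noteq> v" for u v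
  proof -
    have "?P {S. u \<in> S \<and> v \<in> S} = ?P {S. u \<in> S \<inter> {u} \<and> v \<in> S \<inter> {v}}" by simp
    also have "\<dots> = ?P {S. u \<in> S \<inter> {u}} * ?P {S. v \<in> S \<inter> {v}}"
      unfolding random_subset_conv_bern by (rule bern_subset_indep) (use uv in auto)
    finally show ?thesis using one uv by simp
  qed
  have "?P {S. t < \<bar>(\<Sum>v\<in>S. w v) - q * (\<Sum>v=1..n. w v)\<bar>}
      = ?P {S. t < \<bar>(\<Sum>v=1..n. w v * of_bool (v \<in> S)) - (\<Sum>v=1..n. w v * ?P {S. v \<in> S})\<bar>}"
  proof (rule pmf_prob_cong)
    fix S assume "S \<in> set_pmf (random_subset n q)"
    then have "S \<subseteq> {1..n}" unfolding random_subset_conv_bern by (rule set_bern_subset)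
    then have "{1..n} \<inter> S = S" by auto
    moreover have "(\<Sum>v=1..n. w v * of_bool (v \<in> S)) = (\<Sum>v\<in>{1..n} \<inter> S. w v)"
      by (simp add: of_bool_def if_distrib[of "\<lambda>x. _ * x"] sum.inter_restrict cong: if_cong)
    ultimately have "(\<Sum>v=1..n. w v * of_bool (v \<in> S)) = (\<Sum>v\<in>S. w v)" by simp
    moreover have "(\<Sum>v=1..n. w v * ?P {S. v \<in> S}) = q * (\<Sum>v=1..n. w v)"
      unfolding sum_distrib_left using one by (intro sum.cong) auto
    ultimately show "(t < \<bar>(\<Sum>v\<in>S. w v) - q * (\<Sum>v=1..n. w v)\<bar>)
      = (t < \<bar>(\<Sum>v=1..n. w v * of_bool (v \<in> S)) - (\<Sum>v=1..n. w v * ?P {S. v \<in> S})\<bar>)" by simp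
  qed
  also have "\<dots> \<le> (\<Sum>u=1..n. \<Sum>v=1..n. w u * w v * (?P {S. u \<in> S \<and> v \<in> S} - ?P {S. u \<in> S} * ?P {S. v \<in> S})) / t\<^sup>2"
    by (rule pmf_weighted_chebyshev) (use t in auto)
  also have "\<dots> \<le> (q * (\<Sum>v=1..n. (w v)\<^sup>2)) / t\<^sup>2"
  proof (rule divide_right_mono)
    have "(\<Sum>u=1..n. \<Sum>v=1..n. w u * w v * (?P {S. u \<in> S \<and> v \<in> S} - ?P {S. u \<in> S} * ?P {S. v \<in> S}))
        = (\<Sum>u=1..n. \<Sum>v=1..n. if u = v then (w u)\<^sup>2 * (q - q * q) else 0)"
      by (intro sum.cong refl) (use one two in \<open>auto simp: power2_eq_square\<close>)
    also have "\<dots> = (\<Sum>u=1..n. (w u)\<^sup>2 * (q - q * q))" by simp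
    also have "\<dots> \<le> (\<Sum>u=1..n. (w u)\<^sup>2 * q)" by (intro sum_mono mult_left_mono) auto
    finally show "(\<Sum>u=1..n. \<Sum>v=1..n. w u * w v * (?P {S. u \<in> S \<and> v \<in> S} - ?P {S. u \<in> S} * ?P {S. v \<in> S}))
        \<le> q * (\<Sum>v=1..n. (w v)\<^sup>2)" by (simp add: sum_distrib_left mult.commute)
  qed simp
  finally show ?thesis .
qed

text \<open>Each \<open>Ntil\<close> rounds a cumulative sum to the nearest integer, with error at
  most 1/2; a difference of two consecutive ones recovers the point masses up to 1. For i = 0 there
  is only one rounding.\<close>

lemma nA_approx:
  "\<bar>real_of_int (nA n dd q i) - q * (\<Sum>v=1..n. pmf (binomial_pmf (dd v) q) i)\<bar> \<le> 1"
proof -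
  define F where "F k = q * (\<Sum>v=1..n. measure_pmf.prob (binomial_pmf (dd v) q) {..k})" for k :: nat
  have N: "\<bar>real_of_int (Ntil n dd q k) - F k\<bar> \<le> 1 / 2" for k
    unfolding Ntil_def F_def by linarith
  show ?thesis
  proof (cases i)
    case 0
    have "{..0::nat} = {0}" by auto
    then have "F 0 = q * (\<Sum>v=1..n. pmf (binomial_pmf (dd v) q) 0)"
      unfolding F_def by (simp add: measure_pmf_single)
    then show ?thesis using N[of 0] unfolding 0 nA_def by simp
  next
    case (Suc k)
    have "measure_pmf.prob (binomial_pmf (dd v) q) {..Suc k}
        = measure_pmf.prob (binomial_pmf (dd v) q) {..k} + pmf (binomial_pmf (dd v) q) (Suc k)" for v
    proof -
      have "{..Suc k} = {..k} \<union> {Suc k}" by auto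
      then have "measure_pmf.prob (binomial_pmf (dd v) q) {..Suc k}
          = measure_pmf.prob (binomial_pmf (dd v) q) {..k} + measure_pmf.prob (binomial_pmf (dd v) q) {Suc k}"
        by (simp only:) (rule measure_pmf.finite_measure_Union, auto)
      then show ?thesis by (simp add: measure_pmf_single)
    qed
    then have "F (Suc k) = F k + q * (\<Sum>v=1..n. pmf (binomial_pmf (dd v) q) (Suc k))"
      unfolding F_def by (simp add: sum.distrib ring_distribs)
    moreover have "real_of_int (nA n dd q (Suc k)) = real_of_int (Ntil n dd q (Suc k)) - real_of_int (Ntil n dd q k)"
      unfolding nA_def by simp
    ultimately show ?thesis using N[of k] N[of "Suc k"] unfolding Suc by linarith
  qed
qed

text \<open>A single size n with explicit constants, so that all error bounds are free of limits.
  The numerical bounds on n, \<open>l\<close> and \<open>\<delta>\<close> hold for all large n. The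
  value 1/3 makes (c) separate degrees above C/2 from the counts i \<le> qC/3.\<close>

locale vertex_sample =
  fixes n D :: nat and dd :: "nat \<Rightarrow> nat" and q \<delta> \<epsilon> M l C :: real
  assumes n: "2 \<le> n"
    and ne: "graphs_deg n dd \<noteq> {}"
    and dd: "\<And>i. i \<in> {1..n} \<Longrightarrow> 1 \<le> dd i" "\<And>i. i \<in> {1..n} \<Longrightarrow> dd i \<le> D"
    and M: "M = real (\<Sum>i=1..n. dd i)"
    and l: "l = ln M" "2 \<le> l"
    and C: "C = \<delta> powr (-1/16) / q * l"
    and q: "0 < q" "q < 1 - \<epsilon>" and \<epsilon>: "0 < \<epsilon>"
    and \<delta>: "0 < \<delta>" "20 * \<delta> \<le> 1" "9 * \<delta> powr (1/64) \<le> 1 / 3"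
    and hyp: "(real D)\<^sup>2 * inverse q ^ 12 * l ^ 12 \<le> \<delta> * q * M"
begin

definition s :: real where "s = \<delta> powr (-1/16)"

lemma s_ge_1: "1 \<le> s"
  unfolding s_def using powr_mono2'[of "-1/16" \<delta> 1] \<delta> by simp

text \<open>With \<open>C = s * l / q\<close>, this identity replaces fractional powers of
  \<open>\<delta>\<close> by integer powers of \<open>s\<close>: each factor \<open>\<delta>\<close>
  pays for up to sixteen factors \<open>s\<close>.\<close>

lemma s_power: "s ^ 16 * \<delta> = 1"
proof -
  have "s ^ 16 = \<delta> powr (-1/16 * 16)" unfolding s_def using \<delta> by (subst powr_powr[symmetric]) (simp add: powr_realpow)
  then show ?thesis using \<delta> by (simp add: powr_minus)
qed

lemma s_power_le: "k \<le> 16 \<Longrightarrow> s ^ k * \<delta> \<le> 1"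
  using mult_right_mono[OF power_increasing[OF _ s_ge_1, of k 16], of \<delta>] s_power \<delta> by simp

lemma q_less_1: "q < 1"
  using q \<epsilon> by simp

lemma M_ge_n: "real n \<le> M"
proof -
  have "(\<Sum>i=1..n. 1) \<le> (\<Sum>i=1..n. dd i)" using dd by (intro sum_mono) auto
  then show ?thesis unfolding M by (simp del: of_nat_sum)
qed

lemma M_ge_2: "2 \<le> M" using M_ge_n n by linarith

lemma D_ge_1: "1 \<le> D"
  using dd(1)[of 1] dd(2)[of 1] n by simp

lemma hyp': "(real D)\<^sup>2 * l ^ 12 \<le> \<delta> * q ^ 13 * M"
proof -
  have "(real D)\<^sup>2 * l ^ 12 = q ^ 12 * ((real D)\<^sup>2 * inverse q ^ 12 * l ^ 12)"
    using q by (simp add: field_simps)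
  also have "\<dots> \<le> q ^ 12 * (\<delta> * q * M)" using hyp q by (intro mult_left_mono) auto
  also have "\<dots> = \<delta> * q ^ 13 * M" by (simp add: power_numeral_reduce algebra_simps)
  finally show ?thesis .
qed

lemma l_power_le: "l ^ 12 \<le> \<delta> * q ^ 13 * M"
proof -
  have "1 \<le> (real D)\<^sup>2" using D_ge_1 by simp
  then have "1 * l ^ 12 \<le> (real D)\<^sup>2 * l ^ 12" using l by (intro mult_right_mono) auto
  then show ?thesis using hyp' by simp
qed

lemma D_square_le: "(real D)\<^sup>2 * 4096 \<le> \<delta> * q ^ 13 * M"
proof -
  have "(2::real) ^ 12 \<le> l ^ 12" using l by (intro power_mono) auto
  then have "(real D)\<^sup>2 * 4096 \<le> (real D)\<^sup>2 * l ^ 12" by (intro mult_left_mono) auto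
  then show ?thesis using hyp' by simp
qed

lemma D_small: "20 * D\<^sup>2 \<le> (\<Sum>i=1..n. dd i)"
proof -
  have "\<delta> * q ^ 13 * M \<le> 1 * 1 * M"
    using \<delta> q q_less_1 M_ge_2 by (intro mult_right_mono mult_mono power_le_one) auto
  then have "20 * (real D)\<^sup>2 \<le> M" using D_square_le zero_le_power2[of "real D"] by linarith
  then have "real (20 * D\<^sup>2) \<le> real (\<Sum>i=1..n. dd i)" unfolding M by simp
  then show ?thesis by (simp only: of_nat_le_iff)
qed

lemma C_eq: "C = s * l / q" and qC: "q * C = s * l" and C_pos: "0 < C"
proof -
  show "C = s * l / q" unfolding C s_def by simp
  then show "q * C = s * l" using q by simp
  show "0 < C" unfolding \<open>C = s * l / q\<close> using s_ge_1 l q by simp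
qed

text \<open>Vertices of degree above C/2 therefore fall under (c), which later removes them from the
  counts in (d).\<close>

lemma C_lower: "2 * \<delta> powr (1/32) * C < C / 2"
proof -
  have "\<delta> powr (1/32) = (\<delta> powr (1/64))\<^sup>2"
    using \<delta> by (simp add: powr_power)
  also have "\<dots> \<le> (1/27)\<^sup>2" using \<delta> by (intro power_mono) auto
  finally show ?thesis using C_pos by (simp add: power2_eq_square)
qed

section \<open>Concentration of |S| and d(S), and the binomial tail behind (c)\<close>

lemma size_fails:
  "measure_pmf.prob (random_subset n q)
     {S. \<not> \<bar>real (card S) - n * q\<bar> \<le> 3 * sqrt (ln n / (q * n)) * (n * q)} \<le> 1 / (9 * ln n)"
proof -
  define t where "t = 3 * sqrt (ln n / (q * n)) * (n * q)"
  have ln0: "0 < ln (real n)" using n by simp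
  have t0: "0 < t" unfolding t_def using ln0 n q by simp
  \<comment> \<open>The squared deviation is 9 ln n times the variance bound nq, so the failure
    probability tends to 0, though only logarithmically.\<close>
  have t2: "t\<^sup>2 = 9 * ln n * (n * q)"
    unfolding t_def power_mult_distrib using ln0 q n by (simp add: power2_eq_square field_simps)
  have "measure_pmf.prob (random_subset n q) {S. t < \<bar>(\<Sum>v\<in>S. 1) - q * (\<Sum>v=1..n. 1)\<bar>}
      \<le> q * (\<Sum>v=1..n. 1\<^sup>2) / t\<^sup>2"
    by (rule random_subset_weight_deviation) (use q q_less_1 t0 in auto)
  also have "\<dots> = 1 / (9 * ln n)" unfolding t2 using n q ln0 by simp
  finally show ?thesis unfolding t_def by (simp add: not_le mult.commute)
qed

text \<open>The variance is at most q D M and the squared deviation is q^6 M^(3/2). The ratio D /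
  (q^5 sqrt M) has square at most \<open>\<delta>\<close> by the size hypothesis.\<close>

lemma degree_sum_fails:
  "measure_pmf.prob (random_subset n q)
     {S. \<not> \<bar>(\<Sum>i\<in>S. real (dd i)) - q * M\<bar> \<le> q ^ 2 * M powr (-1/4) * (q * M)} \<le> sqrt \<delta>"
proof -
  define t where "t = q ^ 2 * M powr (-1/4) * (q * M)"
  have M0: "0 < M" using M_ge_2 by simp
  have t0: "0 < t" unfolding t_def using M0 q by simp
  have "(M powr (-1/4))\<^sup>2 = M powr (-1/2)" using M0 by (simp add: powr_power)
  also have "\<dots> = 1 / sqrt M" using M0 by (simp add: powr_minus powr_half_sqrt field_simps)
  finally have "t\<^sup>2 = q ^ 6 * M\<^sup>2 / sqrt M"
    unfolding t_def power_mult_distrib by (simp add: power_numeral_reduce algebra_simps)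
  also have "\<dots> = q ^ 6 * M * sqrt M"
    using M0 by (simp add: power2_eq_square real_div_sqrt field_simps)
  finally have t2: "t\<^sup>2 = q ^ 6 * M * sqrt M" .
  have "measure_pmf.prob (random_subset n q) {S. t < \<bar>(\<Sum>v\<in>S. real (dd v)) - q * (\<Sum>v=1..n. real (dd v))\<bar>}
      \<le> q * (\<Sum>v=1..n. (real (dd v))\<^sup>2) / t\<^sup>2"
    by (rule random_subset_weight_deviation) (use q q_less_1 t0 in auto)
  also have "\<dots> \<le> q * (D * M) / t\<^sup>2"
    unfolding M using dd q by (intro divide_right_mono mult_left_mono sum_squares_le) auto
  also have "\<dots> = D / (q ^ 5 * sqrt M)"
    unfolding t2 using q M0 by (simp add: power_numeral_reduce)
  also have "\<dots> \<le> sqrt \<delta>"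
  proof (rule real_le_rsqrt)
    have "(real D)\<^sup>2 \<le> \<delta> * q ^ 13 * M" using D_square_le zero_le_power2[of "real D"] by linarith
    also have "\<dots> \<le> \<delta> * q ^ 10 * M"
      using q q_less_1 \<delta> M0 by (intro mult_right_mono mult_left_mono power_decreasing) auto
    finally have "(real D)\<^sup>2 \<le> \<delta> * ((q ^ 5)\<^sup>2 * (sqrt M)\<^sup>2)" using M0 by (simp add: power_mult[symmetric])
    then show "(D / (q ^ 5 * sqrt M))\<^sup>2 \<le> \<delta>"
      using q M0 unfolding power_divide power_mult_distrib by (subst pos_divide_le_eq) auto
  qed
  finally show ?thesis unfolding t_def by (simp add: not_le M)
qed

text \<open>The exponents are matched: with x = 9 \<delta>^(1/64), x^2 q N is at least 81
  \<delta>^(1/32) * 2 \<delta>^(1/32) * \<delta>^(-1/16) l = 162 l. A quarter of this exceeds 2 l,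
  and exp (-2 l) = M^-2.\<close>

lemma binomial_tail:
  assumes N: "2 * \<delta> powr (1/32) * C < real N"
  shows "measure_pmf.prob (binomial_pmf N q) {k. 9 * \<delta> powr (1/64) * (q * N) < \<bar>real k - q * N\<bar>} \<le> 2 / M\<^sup>2"
proof -
  define x where "x = 9 * \<delta> powr (1/64)"
  have x: "0 < x" "x \<le> 2" unfolding x_def using \<delta> by auto
  have M0: "0 < M" using M_ge_2 by simp
  have "\<delta> powr (1/32) * \<delta> powr (1/32) * s = 1"
    unfolding s_def using \<delta> by (simp add: powr_add[symmetric])
  then have d: "\<delta> powr (1/32) * (\<delta> powr (1/32) * (s * l)) = l" by (metis mult.assoc mult_1)
  have "162 * l = 81 * \<delta> powr (1/32) * (q * (2 * \<delta> powr (1/32) * C))"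
  proof -
    have "81 * \<delta> powr (1/32) * (q * (2 * \<delta> powr (1/32) * C)) = 162 * (\<delta> powr (1/32) * (\<delta> powr (1/32) * (q * C)))"
      by simp
    then show ?thesis unfolding qC d by simp
  qed
  also have "\<dots> \<le> 81 * \<delta> powr (1/32) * (q * N)"
    using N q by (intro mult_left_mono) auto
  also have "81 * \<delta> powr (1/32) = x\<^sup>2" unfolding x_def power_mult_distrib using \<delta> by (simp add: powr_power)
  finally have "162 * l \<le> x\<^sup>2 * (q * N)" .
  then have "- (x\<^sup>2 * (q * N) / 4) \<le> - 2 * l" using l by simp
  then have "exp (- (x\<^sup>2 * (q * N) / 4)) \<le> exp (- 2 * l)" by simp
  also have "\<dots> = 1 / M\<^sup>2"
  proof -
    have "exp (2 * l) = M\<^sup>2" unfolding l using M0 exp_of_nat_mult[of 2 "ln M"] by simp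
    then show ?thesis by (simp add: exp_minus inverse_eq_divide)
  qed
  finally show ?thesis
    using binomial_chernoff[of q x N] q q_less_1 x unfolding x_def by simp
qed

section \<open>Joint failure probabilities of (c) and of the degree counts\<close>

abbreviation GS :: "(nat set set \<times> nat set) pmf" where
  "GS \<equiv> pair_pmf (random_graph n dd) (random_subset n q)"

definition degrees_ok :: "nat set set \<times> nat set \<Rightarrow> bool" where
  "degrees_ok z \<longleftrightarrow> (\<forall>v\<in>snd z. 2 * \<delta> powr (1/32) * C < real (dd v) \<longrightarrow>
     \<bar>real (degS (fst z) (snd z) v) - q * dd v\<bar> \<le> 9 * \<delta> powr (1/64) * (q * dd v))"

text \<open>For each fixed graph, at most n \<le> M vertices fail, each with probability at most
  2/M^2.\<close>

lemma degrees_fail: "measure_pmf.prob GS {z. \<not> degrees_ok z} \<le> 2 / M"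
proof -
  have M0: "0 < M" using M_ge_2 by simp
  have "measure_pmf.prob GS {(E, S). \<not> degrees_ok (E, S)} \<le> 2 / M"
  proof (rule prob_pair_pmf_le)
    fix E assume "E \<in> set_pmf (random_graph n dd)"
    then have E: "E \<in> graphs_deg n dd" by (simp add: set_random_graph[OF ne])
    define W where "W = {v \<in> {1..n}. 2 * \<delta> powr (1/32) * C < real (dd v)}"
    have "measure_pmf.prob (random_subset n q) {S. \<not> degrees_ok (E, S)}
       \<le> (\<Sum>v\<in>W. measure_pmf.prob (random_subset n q)
            {S. 9 * \<delta> powr (1/64) * (q * dd v) < \<bar>real (degS E S v) - q * dd v\<bar>})"
    proof (rule pmf_union_bound)
      fix S assume "S \<in> set_pmf (random_subset n q)" and bad: "\<not> degrees_ok (E, S)"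
      then have "S \<subseteq> {1..n}" unfolding random_subset_conv_bern by (intro set_bern_subset)
      moreover obtain v where "v \<in> S" "2 * \<delta> powr (1/32) * C < real (dd v)"
          "9 * \<delta> powr (1/64) * (q * dd v) < \<bar>real (degS E S v) - q * dd v\<bar>"
        using bad unfolding degrees_ok_def by (auto simp: not_le)
      ultimately show "\<exists>v\<in>W. 9 * \<delta> powr (1/64) * (q * dd v) < \<bar>real (degS E S v) - q * dd v\<bar>"
        unfolding W_def by blast
    qed (simp add: W_def)
    also have "\<dots> \<le> (\<Sum>v\<in>W. 2 / M\<^sup>2)"
    proof (rule sum_mono)
      fix v assume v: "v \<in> W"
      show "measure_pmf.prob (random_subset n q)
            {S. 9 * \<delta> powr (1/64) * (q * dd v) < \<bar>real (degS E S v) - q * dd v\<bar>} \<le> 2 / M\<^sup>2"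
        using prob_degS[OF E, of v q "\<lambda>k. 9 * \<delta> powr (1/64) * (q * dd v) < \<bar>real k - q * dd v\<bar>"]
          binomial_tail[of "dd v"] v q q_less_1 unfolding W_def by simp
    qed
    also have "\<dots> \<le> (\<Sum>v\<in>{1..n}. 2 / M\<^sup>2)" by (intro sum_mono2) (auto simp: W_def)
    also have "\<dots> = n * (2 / M\<^sup>2)" by simp
    also have "\<dots> \<le> M * (2 / M\<^sup>2)" using M_ge_n by (intro mult_right_mono) auto
    also have "\<dots> = 2 / M" using M0 by (simp add: power2_eq_square)
    finally show "measure_pmf.prob (random_subset n q) {S. \<not> degrees_ok (E, S)} \<le> 2 / M" .
  qed
  then show ?thesis by (simp add: case_prod_unfold)
qed

text \<open>Under (c), a vertex of S of larger degree has degree in S above (2/3) q (C/2) = qC/3,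
  beyond every i counted in (d).\<close>

definition L :: "nat set" where "L = {v \<in> {1..n}. real (dd v) \<le> C / 2}"

definition mL :: "nat \<Rightarrow> real" where "mL i = (\<Sum>v\<in>L. q * pmf (binomial_pmf (dd v) q) i)"

text \<open>Only half of the additive error of (d) is spent here; the rest is reserved for passing
  from \<open>mL\<close> to \<open>nA\<close>.\<close>

definition thr :: "nat \<Rightarrow> real" where "thr i = q / C ^ 3 * mL i + q * C ^ 6 / sqrt l / 2"

definition counts_ok :: "nat set set \<times> nat set \<Rightarrow> bool" where
  "counts_ok z \<longleftrightarrow> (\<forall>i::nat. real i \<le> q * C / 3 \<longrightarrow>
     \<bar>(\<Sum>v\<in>L. of_bool (deg_event i v z)) - mL i\<bar> \<le> thr i)"

lemma sqrt_l: "0 < sqrt l" "sqrt l \<le> l"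
proof -
  show "0 < sqrt l" using l by simp
  have "l * 1 \<le> l * l" using l by (intro mult_left_mono) auto
  then show "sqrt l \<le> l" using l by (intro real_le_lsqrt) (auto simp: power2_eq_square)
qed

text \<open>Writing \<open>thr i\<close> as am + R/2, its square dominates both amR and (am)^2. The
  first turns the linear term of the variance into 2/(aR), the second removes m from the quadratic
  term.\<close>

lemma single_count_fails:
  "measure_pmf.prob GS {z. thr i < \<bar>(\<Sum>v\<in>L. of_bool (deg_event i v z)) - mL i\<bar>}
    \<le> 2 * (sqrt l / (q\<^sup>2 * C ^ 3)) + 6 / \<epsilon>\<^sup>2 * (C ^ 8 * D / (M * q ^ 4))"
proof -
  define a where "a = q / C ^ 3"
  define R where "R = q * C ^ 6 / sqrt l"
  define m where "m = mL i"
  \<comment> \<open>A common lower bound for q and 1 - q, as q < 1 - \<epsilon>.\<close>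
  define \<kappa> where "\<kappa> = q * \<epsilon>"
  have M0: "0 < M" using M_ge_2 by simp
  have a0: "0 < a" unfolding a_def using q C_pos by simp
  have R0: "0 < R" unfolding R_def using q C_pos sqrt_l by simp
  have m0: "0 \<le> m" unfolding m_def mL_def using q by (intro sum_nonneg) auto
  have t: "thr i = a * m + R / 2" unfolding thr_def a_def R_def m_def ..
  have t0: "0 < thr i" unfolding t using a0 m0 R0 by (simp add: add_nonneg_pos)
  have e1: "\<epsilon> < 1" using q by simp
  have \<kappa>: "0 < \<kappa>" "\<kappa> \<le> q" "\<kappa> \<le> 1 - q"
  proof -
    show "0 < \<kappa>" unfolding \<kappa>_def using q \<epsilon> by simp
    have "q * \<epsilon> \<le> q * 1" "q * \<epsilon> \<le> 1 * \<epsilon>" using q q_less_1 e1 \<epsilon> by (auto intro!: mult_mono)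
    then show "\<kappa> \<le> q" "\<kappa> \<le> 1 - q" unfolding \<kappa>_def using q by auto
  qed
  have small: "24 * C ^ 4 * (real D)\<^sup>2 \<le> M"
  proof -
    have "s ^ 4 * ((real D)\<^sup>2 * l ^ 12) \<le> s ^ 4 * (\<delta> * q ^ 13 * M)"
      using hyp' s_ge_1 by (intro mult_left_mono) auto
    also have "\<dots> = (s ^ 4 * \<delta>) * (q ^ 13 * M)" by simp
    also have "\<dots> \<le> 1 * (q ^ 4 * M)"
      using s_power_le[of 4] s_ge_1 \<delta> q q_less_1 M0
      by (intro mult_mono mult_right_mono power_decreasing) auto
    finally have "s ^ 4 * ((real D)\<^sup>2 * l ^ 12) \<le> q ^ 4 * M" by simp
    moreover have "s ^ 4 * ((real D)\<^sup>2 * l ^ 12) = (s ^ 4 * (real D)\<^sup>2 * l ^ 4) * l ^ 8"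
      by (simp add: power_add[symmetric])
    ultimately have 1: "(s ^ 4 * (real D)\<^sup>2 * l ^ 4) * l ^ 8 \<le> q ^ 4 * M" by simp
    \<comment> \<open>Four of the twelve powers of \<open>l\<close> go into C^4; the other eight are
      worth at least 256 and pay for the factor 24.\<close>
    have "(2::real) ^ 8 \<le> l ^ 8" using l by (intro power_mono) auto
    then have "(s ^ 4 * (real D)\<^sup>2 * l ^ 4) * 24 \<le> (s ^ 4 * (real D)\<^sup>2 * l ^ 4) * l ^ 8"
      using s_ge_1 by (intro mult_left_mono) auto
    with 1 have "24 * (s ^ 4 * l ^ 4) * (real D)\<^sup>2 \<le> M * q ^ 4" by (simp add: mult_ac)
    then have "24 * (s ^ 4 * l ^ 4) * (real D)\<^sup>2 / q ^ 4 \<le> M"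
      using q by (simp add: pos_divide_le_eq)
    then show ?thesis unfolding C_eq by (simp add: power_mult_distrib power_divide)
  qed
  have "measure_pmf.prob GS {z. thr i < \<bar>(\<Sum>v\<in>L. of_bool (deg_event i v z)) - mL i\<bar>}
      \<le> (2 * mL i + 6 * C\<^sup>2 * D / (M * \<kappa>\<^sup>2) * (mL i)\<^sup>2) / (thr i)\<^sup>2"
    unfolding mL_def
  proof (rule deg_count_concentration[OF ne dd(2) D_ge_1 D_small M M_ge_n \<kappa>, where C = C])
    show "L \<subseteq> {1..n}" "\<And>v. v \<in> L \<Longrightarrow> real (dd v) \<le> C" unfolding L_def using C_pos by auto
  qed (use small t0 in auto)
  also have "\<dots> = 2 * m / (thr i)\<^sup>2 + 6 * C\<^sup>2 * D / (M * \<kappa>\<^sup>2) * m\<^sup>2 / (thr i)\<^sup>2"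
    unfolding m_def by (simp add: add_divide_distrib)
  also have "\<dots> \<le> 2 / (a * R) + 6 * C\<^sup>2 * D / (M * \<kappa>\<^sup>2) / a\<^sup>2"
  proof (cases "m = 0")
    case True
    then show ?thesis using a0 R0 M0 by simp
  next
    case False
    with m0 have m0: "0 < m" by simp
    \<comment> \<open>The inequality between the means: (am + R/2)^2 \<ge> 4 * am * (R/2).\<close>
    have "0 \<le> (a * m - R / 2)\<^sup>2" by simp
    then have "2 * (a * m * R) \<le> (thr i)\<^sup>2" unfolding t by (simp add: power2_eq_square algebra_simps)
    moreover have "0 < a * m * R" using a0 m0 R0 by simp
    ultimately have "a * m * R \<le> (thr i)\<^sup>2" by linarith
    then have 1: "2 * m / (thr i)\<^sup>2 \<le> 2 * m / (a * m * R)"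
      using a0 m0 R0 by (intro divide_left_mono) (auto intro!: mult_pos_pos zero_less_power t0)
    have "(a * m)\<^sup>2 \<le> (thr i)\<^sup>2" unfolding t using a0 m0 R0 by (intro power_mono) auto
    then have 2: "6 * C\<^sup>2 * D / (M * \<kappa>\<^sup>2) * m\<^sup>2 / (thr i)\<^sup>2 \<le> 6 * C\<^sup>2 * D / (M * \<kappa>\<^sup>2) * m\<^sup>2 / (a * m)\<^sup>2"
      using a0 m0 M0 by (intro divide_left_mono) (auto intro!: mult_pos_pos zero_less_power t0 mult_nonneg_nonneg)
    show ?thesis using add_mono[OF 1 2] m0 a0 by (simp add: power_mult_distrib)
  qed
  also have "\<dots> = 2 * (sqrt l / (q\<^sup>2 * C ^ 3)) + 6 / \<epsilon>\<^sup>2 * (C ^ 8 * D / (M * q ^ 4))"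
  proof -
    have "a * R = q\<^sup>2 * C ^ 3 / sqrt l"
      unfolding a_def R_def using C_pos by (simp add: power_numeral_reduce)
    moreover have "6 * C\<^sup>2 * D / (M * \<kappa>\<^sup>2) / a\<^sup>2 = 6 / \<epsilon>\<^sup>2 * (C ^ 8 * D / (M * q ^ 4))"
      unfolding a_def \<kappa>_def using C_pos q \<epsilon> M0 by (simp add: field_simps power_numeral_reduce)
    ultimately show ?thesis using sqrt_l q C_pos by simp
  qed
  finally show ?thesis .
qed

text \<open>There are at most qC/3 + 1 \<le> sl values of i, and the bound for a single count is
  small enough that even its sl-fold is of order 1/l.\<close>

lemma counts_fail: "measure_pmf.prob GS {z. \<not> counts_ok z} \<le> (2 + 6 / \<epsilon>\<^sup>2) / l"
proof -
  define I where "I = {i::nat. real i \<le> q * C / 3}"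
  define B where "B = 2 * (sqrt l / (q\<^sup>2 * C ^ 3)) + 6 / \<epsilon>\<^sup>2 * (C ^ 8 * D / (M * q ^ 4))"
  have M0: "0 < M" using M_ge_2 by simp
  have B0: "0 \<le> B" unfolding B_def using sqrt_l C_pos M0 q by simp
  have Isub: "I \<subseteq> {..nat \<lfloor>q * C / 3\<rfloor>}" unfolding I_def by (auto simp: le_nat_floor)
  then have finI: "finite I" by (rule finite_subset) simp
  have sl: "2 \<le> s * l" using mult_mono[OF s_ge_1 l(2)] s_ge_1 by simp
  have le_recip: "x / y \<le> 1 / l" if "l * x \<le> y" "0 < y" for x y :: real
    using that l(2) by (simp add: field_simps)
  have "card I \<le> nat \<lfloor>q * C / 3\<rfloor> + 1" using card_mono[OF _ Isub] by simp
  then have "real (card I) \<le> real (nat \<lfloor>q * C / 3\<rfloor>) + 1" by linarith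
  also have "\<dots> \<le> q * C / 3 + 1"
  proof -
    have "0 \<le> q * C / 3" using q C_pos by simp
    from of_nat_floor[OF this] show ?thesis by linarith
  qed
  also have "\<dots> \<le> s * l" unfolding qC using sl by simp
  finally have cI: "real (card I) \<le> s * l" .
  have "measure_pmf.prob GS {z. \<not> counts_ok z}
     \<le> (\<Sum>i\<in>I. measure_pmf.prob GS {z. thr i < \<bar>(\<Sum>v\<in>L. of_bool (deg_event i v z)) - mL i\<bar>})"
    by (rule pmf_union_bound[OF finI]) (auto simp: counts_ok_def I_def not_le)
  also have "\<dots> \<le> (\<Sum>i\<in>I. B)" unfolding B_def by (intro sum_mono single_count_fails)
  also have "\<dots> = real (card I) * B" by simp
  also have "\<dots> \<le> (s * l) * B" using cI B0 by (intro mult_right_mono)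
  also have "\<dots> = 2 * (s * l * sqrt l / (q\<^sup>2 * C ^ 3)) + 6 / \<epsilon>\<^sup>2 * (s * l * C ^ 8 * D / (M * q ^ 4))"
    unfolding B_def by (simp add: algebra_simps)
  also have "\<dots> \<le> 2 * (1 / l) + 6 / \<epsilon>\<^sup>2 * (1 / l)"
  proof (intro add_mono mult_left_mono)
    have "s * l * sqrt l * l \<le> s * l * l * l" using sqrt_l s_ge_1 l by (intro mult_mono) auto
    also have "\<dots> = s ^ 1 * l ^ 3 * 1" by (simp add: power_numeral_reduce)
    also have "\<dots> \<le> s ^ 3 * l ^ 3 * (1 / q)"
      using s_ge_1 l q q_less_1 by (intro mult_mono power_increasing) auto
    also have "\<dots> = q\<^sup>2 * C ^ 3" unfolding C_eq using q by (simp add: field_simps power_numeral_reduce)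
    finally show "s * l * sqrt l / (q\<^sup>2 * C ^ 3) \<le> 1 / l"
      using q C_pos l by (simp add: field_simps)
    have "l ^ 10 * s ^ 9 * D \<le> M * q ^ 12"
    \<comment> \<open>Squaring creates the D^2 of \<open>hyp'\<close>. The size hypothesis enters
      twice: its first \<open>\<delta>\<close> cancels s^16, and its second, from
      \<open>l_power_le\<close>, absorbs the remaining s^2.\<close>
    proof (rule power2_le_imp_le)
      have "(l ^ 10 * s ^ 9 * D)\<^sup>2 = s ^ 18 * l ^ 8 * ((real D)\<^sup>2 * l ^ 12)"
        by (simp add: power_mult_distrib power_mult[symmetric] power_add[symmetric] mult_ac)
      also have "\<dots> \<le> s ^ 18 * l ^ 8 * (\<delta> * q ^ 13 * M)"
        using hyp' s_ge_1 l by (intro mult_left_mono) auto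
      also have "\<dots> = (s ^ 16 * \<delta>) * (s\<^sup>2 * l ^ 8 * q ^ 13 * M)"
        by (simp add: power_add[symmetric] mult_ac)
      also have "\<dots> = (s\<^sup>2 * l ^ 8) * (q ^ 13 * M)" unfolding s_power by simp
      also have "\<dots> \<le> (s\<^sup>2 * l ^ 12) * (q ^ 13 * M)"
        using s_ge_1 l q M0 by (intro mult_right_mono mult_left_mono power_increasing) auto
      also have "\<dots> \<le> (s\<^sup>2 * (\<delta> * q ^ 13 * M)) * (q ^ 13 * M)"
        using l_power_le s_ge_1 q M0 by (intro mult_right_mono mult_left_mono) auto
      also have "\<dots> = (s\<^sup>2 * \<delta>) * (q ^ 26 * M\<^sup>2)"
        by (simp add: power_add[symmetric] mult_ac power2_eq_square)
      also have "\<dots> \<le> 1 * (q ^ 24 * M\<^sup>2)"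
        using s_power_le[of 2] \<delta> q q_less_1
        by (intro mult_mono mult_right_mono power_decreasing) auto
      also have "\<dots> = (M * q ^ 12)\<^sup>2" by (simp add: power_mult_distrib power_mult[symmetric])
      finally show "(l ^ 10 * s ^ 9 * D)\<^sup>2 \<le> (M * q ^ 12)\<^sup>2" .
    qed (use M0 q in auto)
    then have "l * (l ^ 9 * s ^ 9 * D / q ^ 8) \<le> M * q ^ 4"
      using q by (simp add: field_simps power_numeral_reduce)
    moreover have "s * l * C ^ 8 * D = l ^ 9 * s ^ 9 * D / q ^ 8"
      unfolding C_eq by (simp add: field_simps power_numeral_reduce)
    ultimately have "l * (s * l * C ^ 8 * D) \<le> M * q ^ 4" by simp
    then show "s * l * C ^ 8 * D / (M * q ^ 4) \<le> 1 / l"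
      by (rule le_recip) (use M0 q in simp)
  qed (use \<epsilon> in auto)
  also have "\<dots> = (2 + 6 / \<epsilon>\<^sup>2) / l" by (simp add: add_divide_distrib)
  finally show ?thesis .
qed

text \<open>Outside \<open>L\<close> the value i lies in the tail of its binomial: i \<le> qC/3 is
  below two thirds of the mean. At most n \<le> M such terms of size 2/M^2 total at most 1.\<close>

lemma mean_approx:
  assumes i: "real i \<le> q * C / 3"
  shows "\<bar>q * (\<Sum>v=1..n. pmf (binomial_pmf (dd v) q) i) - mL i\<bar> \<le> 1"
proof -
  let ?f = "\<lambda>v. pmf (binomial_pmf (dd v) q) i"
  have M0: "0 < M" using M_ge_2 by simp
  have "(\<Sum>v=1..n. ?f v) = (\<Sum>v\<in>{1..n} - L. ?f v) + (\<Sum>v\<in>L. ?f v)"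
    by (rule sum.subset_diff) (auto simp: L_def)
  then have eq: "q * (\<Sum>v=1..n. ?f v) - mL i = q * (\<Sum>v\<in>{1..n} - L. ?f v)"
    unfolding mL_def by (simp add: sum_distrib_left[symmetric] ring_distribs)
  have "(\<Sum>v\<in>{1..n} - L. ?f v) \<le> (\<Sum>v\<in>{1..n} - L. 2 / M\<^sup>2)"
  proof (rule sum_mono)
    fix v assume "v \<in> {1..n} - L"
    then have v: "C / 2 < real (dd v)" unfolding L_def by auto
    have "9 * \<delta> powr (1/64) * (q * dd v) \<le> 1 / 3 * (q * dd v)"
      using \<delta> q by (intro mult_right_mono) auto
    moreover have "q * (C / 2) < q * dd v" using v q by (intro mult_strict_left_mono) auto
    ultimately have "9 * \<delta> powr (1/64) * (q * dd v) < \<bar>real i - q * dd v\<bar>" using i by linarith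
    then have "measure_pmf.prob (binomial_pmf (dd v) q) {i}
        \<le> measure_pmf.prob (binomial_pmf (dd v) q) {k. 9 * \<delta> powr (1/64) * (q * dd v) < \<bar>real k - q * dd v\<bar>}"
      by (intro measure_pmf.finite_measure_mono) auto
    also have "\<dots> \<le> 2 / M\<^sup>2" using C_lower v by (intro binomial_tail) auto
    finally show "?f v \<le> 2 / M\<^sup>2" by (simp add: measure_pmf_single)
  qed
  also have "\<dots> \<le> (\<Sum>v\<in>{1..n}. 2 / M\<^sup>2)" by (intro sum_mono2) auto
  also have "\<dots> = n * (2 / M\<^sup>2)" by simp
  also have "\<dots> \<le> M * (2 / M\<^sup>2)" using M_ge_n by (intro mult_right_mono) auto
  also have "\<dots> = 2 / M" using M0 by (simp add: power2_eq_square)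
  also have "\<dots> \<le> 1" using M_ge_2 by simp
  finally have "(\<Sum>v\<in>{1..n} - L. ?f v) \<le> 1" .
  moreover have "0 \<le> (\<Sum>v\<in>{1..n} - L. ?f v)" by (intro sum_nonneg) auto
  ultimately have "\<bar>q * (\<Sum>v\<in>{1..n} - L. ?f v)\<bar> \<le> 1 * 1"
    unfolding abs_mult using q q_less_1 by (intro mult_mono) auto
  then show ?thesis unfolding eq by simp
qed

lemma nS_conv:
  assumes S: "S \<subseteq> {1..n}" and ok: "degrees_ok (E, S)" and i: "real i \<le> q * C / 3"
  shows "real (nS E S i) = (\<Sum>v\<in>L. of_bool (deg_event i v (E, S)))"
proof -
  have "v \<in> L" if v: "v \<in> S" "degS E S v = i" for v
  proof (rule ccontr)
    assume "v \<notin> L"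
    then have dv: "C / 2 < real (dd v)" using v S unfolding L_def by auto
    then have "\<bar>real (degS E S v) - q * dd v\<bar> \<le> 9 * \<delta> powr (1/64) * (q * dd v)"
      using ok v C_lower unfolding degrees_ok_def by auto
    also have "\<dots> \<le> 1 / 3 * (q * dd v)" using \<delta> q by (intro mult_right_mono) auto
    finally have "\<bar>real (degS E S v) - q * dd v\<bar> \<le> 1 / 3 * (q * dd v)" .
    moreover have "q * (C / 2) < q * dd v" using dv q by (intro mult_strict_left_mono) auto
    ultimately show False using i v by linarith
  qed
  then have "{v \<in> S. degS E S v = i} = L \<inter> {v. deg_event i v (E, S)}"
    unfolding deg_event_def by auto
  moreover have "finite L" unfolding L_def by simp
  ultimately show ?thesis unfolding nS_def by simp
qed

text \<open>\<open>nA\<close> and \<open>mL\<close> differ by at most 2, one unit for rounding and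
  one for high degrees. The exchange costs 2 in the deviation and at most 2 in the relative term, as
  a \<le> 1; the spare R/2 covers this once R \<ge> 8.\<close>

lemma counts_good:
  assumes S: "S \<subseteq> {1..n}" and ok: "degrees_ok (E, S)" "counts_ok (E, S)" and i: "real i \<le> q * C / 3"
  shows "\<bar>real (nS E S i) - real_of_int (nA n dd q i)\<bar>
    \<le> q * real_of_int (nA n dd q i) / C ^ 3 + q * C ^ 6 / sqrt l"
proof -
  define a where "a = q / C ^ 3"
  define R where "R = q * C ^ 6 / sqrt l"
  let ?A = "real_of_int (nA n dd q i)"
  have C1: "1 \<le> C"
  proof -
    have "1 * q \<le> s * l" using s_ge_1 l q q_less_1 by (intro mult_mono) auto
    then show ?thesis unfolding C_eq using q by (simp add: field_simps)
  qed
  have a: "0 \<le> a" "a \<le> 1"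
  proof -
    show "0 \<le> a" unfolding a_def using q C_pos by simp
    have "1 \<le> C ^ 3" using C1 by simp
    then show "a \<le> 1" unfolding a_def using q_less_1 C_pos by (subst pos_divide_le_eq) auto
  qed
  have R: "8 \<le> R"
  proof -
    have "8 * sqrt l \<le> 2 ^ 4 * l" using sqrt_l by simp
    also have "\<dots> \<le> l ^ 4 * l" using l by (intro mult_right_mono power_mono) auto
    also have "\<dots> \<le> l ^ 5 * (s * 1)" using s_ge_1 l by (simp add: power_numeral_reduce mult_le_cancel_left1)
    also have "\<dots> \<le> l ^ 6 * s" using l s_ge_1 by (simp add: power_numeral_reduce)
    also have "\<dots> = (s * l) * l ^ 5" by (simp add: power_numeral_reduce)
    also have "\<dots> \<le> (s * l) * C ^ 5"
    proof (intro mult_left_mono power_mono)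
      have "l * q \<le> s * l" using l s_ge_1 q q_less_1 by (subst mult.commute) (intro mult_mono, auto)
      then show "l \<le> C" unfolding C_eq using q by (simp add: pos_le_divide_eq)
    qed (use l s_ge_1 in auto)
    also have "\<dots> = q * C ^ 6" unfolding qC[symmetric] by (simp add: power_numeral_reduce)
    finally show ?thesis unfolding R_def using sqrt_l by (simp add: pos_le_divide_eq)
  qed
  have 1: "\<bar>real (nS E S i) - mL i\<bar> \<le> a * mL i + R / 2"
    using ok(2) i unfolding nS_conv[OF S ok(1) i] counts_ok_def thr_def a_def R_def by simp
  have 2: "\<bar>?A - mL i\<bar> \<le> 2" using nA_approx[of n dd q i] mean_approx[OF i] by linarith
  have "a * mL i \<le> a * (?A + 2)" using a 2 by (intro mult_left_mono) linarith+
  also have "\<dots> \<le> a * ?A + 2" using a by (simp add: ring_distribs)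
  finally have "\<bar>real (nS E S i) - ?A\<bar> \<le> a * ?A + R" using 1 2 R by linarith
  then show ?thesis unfolding a_def R_def by simp
qed

text \<open>A union bound over four failures. The estimate for \<open>nS\<close> is no separate
  event: it follows from \<open>counts_ok\<close> on the event \<open>degrees_ok\<close>, where
  high-degree vertices cannot be counted.\<close>

lemma prob_all_good:
  "1 - (1 / (9 * ln n) + sqrt \<delta> + 2 / M + (2 + 6 / \<epsilon>\<^sup>2) / l)
    \<le> measure_pmf.prob GS
       {(E, S).
          \<bar>real (card S) - n * q\<bar> \<le> 3 * sqrt (ln n / (q * n)) * (n * q)
        \<and> \<bar>(\<Sum>i\<in>S. real (dd i)) - q * M\<bar> \<le> q ^ 2 * M powr (-1/4) * (q * M)
        \<and> (\<forall>v\<in>S. real (dd v) > 2 * \<delta> powr (1/32) * C \<longrightarrow>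
              \<bar>real (degS E S v) - q * dd v\<bar> \<le> 9 * \<delta> powr (1/64) * (q * dd v))
        \<and> (\<forall>i::nat. real i \<le> q * C / 3 \<longrightarrow>
              \<bar>real (nS E S i) - real_of_int (nA n dd q i)\<bar>
                \<le> q * real_of_int (nA n dd q i) / C ^ 3 + q * C ^ 6 / sqrt l)}"
    (is "_ \<le> measure_pmf.prob GS ?G")
proof -
  define A1 where "A1 S \<longleftrightarrow> \<bar>real (card S) - n * q\<bar> \<le> 3 * sqrt (ln n / (q * n)) * (n * q)" for S :: "nat set"
  define A2 where "A2 S \<longleftrightarrow> \<bar>(\<Sum>i\<in>S. real (dd i)) - q * M\<bar> \<le> q ^ 2 * M powr (-1/4) * (q * M)" for S
  let ?P = "measure_pmf.prob GS"
  have snd: "?P {z. \<not> B (snd z)} = measure_pmf.prob (random_subset n q) {S. \<not> B S}" for B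
  proof -
    have "measure_pmf.prob (map_pmf snd GS) {S. \<not> B S} = ?P {z. \<not> B (snd z)}"
      by (simp add: vimage_def)
    then show ?thesis by (simp add: map_snd_pair_pmf)
  qed
  define bad where "bad = (\<lambda>j::nat. \<lambda>z. if j = 0 then \<not> A1 (snd z) else if j = 1 then \<not> A2 (snd z)
      else if j = 2 then \<not> degrees_ok z else \<not> counts_ok z)"
  have "?P {z. z \<notin> ?G} \<le> (\<Sum>j\<in>{0, 1, 2, 3}. ?P {z. bad j z})"
  proof (rule pmf_union_bound)
    fix z assume z: "z \<in> set_pmf GS" and nG: "z \<notin> ?G"
    obtain E S where zES: "z = (E, S)" by (cases z)
    then have S: "S \<subseteq> {1..n}" using z unfolding random_subset_conv_bern by (auto dest!: set_bern_subset)
    have "\<not> (A1 S \<and> A2 S \<and> degrees_ok z \<and> counts_ok z)"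
      using nG counts_good[OF S] unfolding zES A1_def A2_def degrees_ok_def by auto
    then show "\<exists>j\<in>{0, 1, 2, 3}. bad j z" unfolding bad_def zES by auto
  qed simp
  also have "\<dots> = ?P {z. \<not> A1 (snd z)} + ?P {z. \<not> A2 (snd z)} + ?P {z. \<not> degrees_ok z} + ?P {z. \<not> counts_ok z}"
    unfolding bad_def by simp
  also have "\<dots> \<le> 1 / (9 * ln n) + sqrt \<delta> + 2 / M + (2 + 6 / \<epsilon>\<^sup>2) / l"
    unfolding snd
    by (intro add_mono degrees_fail counts_fail)
       (use size_fails degree_sum_fails in \<open>simp_all add: A1_def A2_def\<close>)
  finally have "?P {z. z \<notin> ?G} \<le> 1 / (9 * ln n) + sqrt \<delta> + 2 / M + (2 + 6 / \<epsilon>\<^sup>2) / l" .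
  moreover have "?P {z. z \<notin> ?G} = 1 - ?P ?G"
    using measure_pmf.prob_compl[of ?G GS] by (simp add: Compl_eq_Diff_UNIV[symmetric] Compl_eq)
  ultimately show ?thesis by linarith
qed

end

section \<open>The asymptotic statement\<close>

theorem theorem2p6:
  fixes d :: "nat \<Rightarrow> nat \<Rightarrow> nat" and p \<delta> :: "nat \<Rightarrow> real"
  defines "M \<equiv> \<lambda>n. real (\<Sum>i=1..n. d n i)"
      and "\<Delta> \<equiv> \<lambda>n. real (d n n)"
      and "Cp \<equiv> \<lambda>n. \<delta> n powr (-1/16) / p n * ln (real (\<Sum>i=1..n. d n i))"
  assumes hyp: "eventually (\<lambda>n. 1 \<le> d n 1 \<and> (\<forall>i. 1 \<le> i \<and> i < n \<longrightarrow> d n i \<le> d n (Suc i))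
              \<and> even (\<Sum>i=1..n. d n i) \<and> 0 < p n \<and> p n < 1 \<and> 0 < \<delta> n
              \<and> graphs_deg n (d n) \<noteq> {}
              \<and> \<Delta> n ^ 2 * inverse (p n) ^ 12 * ln (M n) ^ 12 \<le> \<delta> n * p n * M n) sequentially"
      and eps: "\<exists>\<epsilon>>0. eventually (\<lambda>n. p n < 1 - \<epsilon>) sequentially"
      and delta_lim: "(\<delta> \<longlongrightarrow> 0) sequentially"
      and delta_O: "(\<lambda>n. 1 / \<delta> n) \<in> O(\<lambda>n. ln (ln (M n)))"
  shows "\<exists>\<eta> :: nat \<Rightarrow> real. (\<eta> \<longlongrightarrow> 0) sequentially \<and>
    ((\<lambda>n. measure_pmf.prob (pair_pmf (random_graph n (d n)) (random_subset n (p n)))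
       {(E, S).
          \<bar>real (card S) - n * p n\<bar> \<le> 3 * sqrt (ln n / (p n * n)) * (n * p n)
        \<and> \<bar>(\<Sum>i\<in>S. real (d n i)) - p n * M n\<bar> \<le> p n ^ 2 * M n powr (-1/4) * (p n * M n)
        \<and> (\<forall>v\<in>S. real (d n v) > 2 * \<delta> n powr (1/32) * Cp n \<longrightarrow>
              \<bar>real (degS E S v) - p n * d n v\<bar> \<le> 9 * \<delta> n powr (1/64) * (p n * d n v))
        \<and> (\<forall>i::nat. real i \<le> p n * Cp n / 3 \<longrightarrow>
              \<bar>real (nS E S i) - real_of_int (nA n (d n) (p n) i)\<bar>
                \<le> p n * real_of_int (nA n (d n) (p n) i) / Cp n ^ 3 * (1 + \<eta> n)
                   + p n * Cp n ^ 6 / sqrt (ln (M n)))})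
     \<longlongrightarrow> 1) sequentially"
proof -
  obtain \<epsilon> where \<epsilon>: "0 < \<epsilon>" and p_less: "eventually (\<lambda>n. p n < 1 - \<epsilon>) sequentially"
    using eps by blast
  define good where "good n = {(E, S).
          \<bar>real (card S) - n * p n\<bar> \<le> 3 * sqrt (ln n / (p n * n)) * (n * p n)
        \<and> \<bar>(\<Sum>i\<in>S. real (d n i)) - p n * M n\<bar> \<le> p n ^ 2 * M n powr (-1/4) * (p n * M n)
        \<and> (\<forall>v\<in>S. real (d n v) > 2 * \<delta> n powr (1/32) * Cp n \<longrightarrow>
              \<bar>real (degS E S v) - p n * d n v\<bar> \<le> 9 * \<delta> n powr (1/64) * (p n * d n v))
        \<and> (\<forall>i::nat. real i \<le> p n * Cp n / 3 \<longrightarrow>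
              \<bar>real (nS E S i) - real_of_int (nA n (d n) (p n) i)\<bar>
                \<le> p n * real_of_int (nA n (d n) (p n) i) / Cp n ^ 3
                   + p n * Cp n ^ 6 / sqrt (ln (M n)))}" for n
  define prb where "prb n = measure_pmf.prob (pair_pmf (random_graph n (d n)) (random_subset n (p n))) (good n)" for n
  \<comment> \<open>Since M n \<ge> n, the error is stated in terms of n, so its limit needs no
    knowledge of the growth of M.\<close>
  define err where "err n = 1 / (9 * ln (real n)) + sqrt (\<delta> n) + 2 / real n + (2 + 6 / \<epsilon>\<^sup>2) / ln (real n)" for n
  have "((\<lambda>n. 1 / (9 * ln (real n))) \<longlongrightarrow> 0) sequentially" "((\<lambda>n. 2 / real n) \<longlongrightarrow> 0) sequentially"
    "((\<lambda>n. (2 + 6 / \<epsilon>\<^sup>2) / ln (real n)) \<longlongrightarrow> 0) sequentially"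
    by real_asymp+
  moreover have "((\<lambda>n. sqrt (\<delta> n)) \<longlongrightarrow> 0) sequentially"
    using tendsto_real_sqrt[OF delta_lim] by simp
  ultimately have "(err \<longlongrightarrow> 0 + 0 + 0 + 0) sequentially"
    unfolding err_def by (intro tendsto_add)
  then have lower: "((\<lambda>n. 1 - err n) \<longlongrightarrow> 1) sequentially"
    using tendsto_diff[OF tendsto_const] by fastforce
  have "eventually (\<lambda>n. 0 \<le> \<delta> n) sequentially"
    using hyp by eventually_elim auto
  then have "((\<lambda>n. \<delta> n powr (1/64)) \<longlongrightarrow> 0) sequentially"
    by (intro tendsto_zero_powrI[OF delta_lim tendsto_const]) auto
  \<comment> \<open>1/27 is what 9 \<delta>^(1/64) \<le> 1/3 requires.\<close>
  then have "eventually (\<lambda>n. \<delta> n powr (1/64) < 1/27) sequentially"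
    by (rule order_tendstoD) simp
  moreover have "eventually (\<lambda>n. \<delta> n < 1/20) sequentially"
    by (rule order_tendstoD[OF delta_lim]) simp
  moreover have "eventually (\<lambda>n. 2 \<le> n) sequentially" by (rule eventually_ge_at_top)
  moreover have "eventually (\<lambda>n. 2 \<le> ln (real n)) sequentially" by real_asymp
  ultimately have "eventually (\<lambda>n. 1 - err n \<le> prb n) sequentially"
    using hyp p_less
  proof eventually_elim
    case (elim n)
    have mono: "d n i \<le> d n j" if "i \<in> {1..n}" "j \<in> {1..n}" "i \<le> j" for i j
      using that(3,1,2)
    proof (induction j rule: dec_induct)
      case (step m)
      then have "d n i \<le> d n m" by auto
      also have "\<dots> \<le> d n (Suc m)" using elim step by auto
      finally show ?case .
    qed simp
    have d1: "1 \<le> d n i" if "i \<in> {1..n}" for i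
      using mono[of 1 i] that elim by auto
    have Mn: "real n \<le> M n"
    proof -
      have "(\<Sum>i=1..n. 1) \<le> (\<Sum>i=1..n. d n i)" using d1 by (intro sum_mono) auto
      then show ?thesis unfolding M_def by (simp del: of_nat_sum)
    qed
    have lM: "ln (real n) \<le> ln (M n)" using Mn elim by (subst ln_le_cancel_iff) auto
    interpret vertex_sample n "d n n" "d n" "p n" "\<delta> n" \<epsilon> "M n" "ln (M n)" "Cp n"
    proof
      show "d n i \<le> d n n" if "i \<in> {1..n}" for i using mono[of i n] that elim by auto
      show "2 \<le> ln (M n)" using lM elim by linarith
      show "Cp n = \<delta> n powr (- 1 / 16) / p n * ln (M n)" unfolding Cp_def M_def ..
      show "(real (d n n))\<^sup>2 * inverse (p n) ^ 12 * ln (M n) ^ 12 \<le> \<delta> n * p n * M n"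
        using elim unfolding \<Delta>_def by blast
    qed (use elim d1 \<epsilon> in \<open>auto simp: M_def\<close>)
    have "2 / M n \<le> 2 / real n" using Mn elim by (intro divide_left_mono) auto
    moreover have "(2 + 6 / \<epsilon>\<^sup>2) / ln (M n) \<le> (2 + 6 / \<epsilon>\<^sup>2) / ln (real n)"
      using lM elim \<epsilon> by (intro divide_left_mono) auto
    ultimately show ?case
      using prob_all_good unfolding prb_def good_def err_def by linarith
  qed
  then have "(prb \<longlongrightarrow> 1) sequentially"
    by (intro tendsto_sandwich[OF _ _ lower tendsto_const]) (auto simp: prb_def)
  then show ?thesis
    unfolding prb_def good_def by (intro exI[of _ "\<lambda>_. 0"]) simp
qed

end
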